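(* Let $I=\{i_1<\dots<i_k\}$ be the pivot indices for the plabic network $(\mathcal N,\mathcal O,\mathfrak l)$. Let $E_e$ be the system of edge vectors on $(\mathcal N,\mathcal O,\mathfrak l)$ satisfying the boundary conditions given by the canonical basis vectors $E_j$ at the boundary sinks $b_j$, $j\in\bar I$. Assume that we change the orientation along a simple closed directed cycle $\mathcal Q_0$ and let $(\mathcal N,\hat{\mathcal O},\mathfrak l)$ be the newly oriented network. Then the system of vectors $$\hat E_e=\begin{cases}(-1)^{\gamma(e)}E_e & e\notin\mathcal Q_0,\\[1mm] \dfrac{(-1)^{\gamma(e)}}{w_e}E_e & e\in\mathcal Q_0,\end{cases}$$ with $\gamma(e)$ as defined in the context, is the system of edge vectors on $(\mathcal N,\hat{\mathcal O},\mathfrak l)$ satisfying the same boundary conditions $E_j$ at the boundary sinks $b_j$, $j\in\bar I$.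
   Context: **Plabic networks.** Let $D$ be a closed convex disk whose boundary contains a straight segment. A plabic graph $\mathcal G$ is a finite directed planar graph embedded in $D$ with straight edges. It has boundary vertices $b_1,\dots,b_n$ on the segment, labelled clockwise, each of degree 1 (a source if its edge is outgoing, a sink otherwise). The remaining (internal) vertices lie inside $D$ and have degree 2 or 3. No component is isolated from the boundary. The graph is perfect: each internal vertex has exactly one incoming edge (then it is white) or exactly one outgoing edge (then it is black); bivalent vertices have one incoming and one outgoing edge and either color. Perfect orientations are those compatible with the coloring. $I$ is the set of indices of the boundary sources (pivot indices), $\bar I=[n]\setminus I$. A network has a positive weight $w_e$ on each directed edge. When the orientation changes, reversed edges get the reciprocal weight and the others keep theirs. ($w_e$ in the claim is the weight in the initial orientation.) **Gauge rays.** A gauge ray direction $\mathfrak l$ is an oriented direction, not parallel to any edge, such that the rays with direction $\mathfrak l$ starting at boundary vertices point inside $D$ and contain no internal vertices. The gauge rays are those starting at the boundary sources, and $\mathrm{int}(e)$ is the number of their intersections with $e$ (base points not counted). **Winding.** $s(a,b)=+1,0,-1$ if the ordered pair $(a,b)$ is positively oriented, parallel, negatively oriented. For consecutive directed edges: $\mathrm{wind}(e,f)=\pm1$ if $s(e,f)=s(e,\mathfrak l)=s(\mathfrak l,f)=\pm1$; otherwise $0$. **System of edge vectors** with boundary conditions $B_j$ at the sinks: the unique solution of $E_e=(-1)^{\mathrm{int}(e)}w_e\sum_f(-1)^{\mathrm{wind}(e,f)}E_f$ (for every edge $e$ ending at an internal vertex $V$, $f$ running over the edges outgoing at $V$), with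 $E_{e_j}=(-1)^{\mathrm{int}(e_j)}w_{e_j}B_j$ at the edge $e_j$ ending at the sink $b_j$ (all quantities computed in the orientation considered). **Index $\gamma(e)$** (computed in the initial orientation $\mathcal O$). The cycle $\mathcal Q_0$ divides the interior of $D$ into two regions: the external one is marked $+$ and the internal one $-$. If $e\notin\mathcal Q_0$: $\gamma(e)=0$ (resp. $1$) if the starting vertex of $e$ lies in the $+$ (resp. $-$) region; if the starting vertex lies on $\mathcal Q_0$, it is first shifted infinitesimally in the direction of $e$. If $e\in\mathcal Q_0$: $\gamma(e)=\gamma_1(e)+\gamma_2(e)+\mathrm{int}(e)$, where $\gamma_1(e)=0$ (resp. $1$) if the region immediately to the left of $e$ near its ending point is marked $+$ (resp. $-$), and $\gamma_2(e)=\frac{1-s(e,\mathfrak l)}2$. *)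

theory Defs
  imports "HOL-Analysis.Analysis" "Graph_Theory.Graph_Theory"
begin

text \<open>
  The plane is \<^typ>\<open>complex\<close>. Edges are straight, so an embedded directed edge is
  the pair (starting point, ending point), and a directed graph drawn in the plane is a
  \<^typ>\<open>complex pair_pre_digraph\<close>.
  The boundary vertices are indexed by a finite linearly ordered type \<open>'n\<close>, which plays the
  role of \<open>[n]\<close>.
\<close>

datatype vertex_colour = White | Black

record 'n plabic_data =
  disk :: "complex set"
  bvert :: "'n \<Rightarrow> complex"
  graph :: "complex pair_pre_digraph"
  colour :: "complex \<Rightarrow> vertex_colour"
  weight :: "complex \<times> complex \<Rightarrow> real"

definition internal :: "'n plabic_data \<Rightarrow> complex set" where
  "internal N = pverts (graph N) - range (bvert N)"

definition edge_dir :: "complex \<times> complex \<Rightarrow> complex" where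
  "edge_dir e = snd e - fst e"

definition edge_seg :: "complex \<times> complex \<Rightarrow> complex set" where
  "edge_seg e = closed_segment (fst e) (snd e)"

text \<open>The sign \<open>s(a,b)\<close> of an ordered pair of plane vectors.\<close>

definition orient :: "complex \<Rightarrow> complex \<Rightarrow> int" where
  "orient a b =
    (let d = Re a * Im b - Im a * Re b in if d > 0 then 1 else if d < 0 then -1 else 0)"

text \<open>
  In \<open>clockwise\<close>: going from \<open>b\<^sub>i\<close> to \<open>b\<^sub>j\<close> with \<open>i < j\<close> along the segment,
  the disk is on the right-hand side. As the disk has interior points, this also makes
  the boundary vertices pairwise distinct.
\<close>

locale plabic_network = pair_digraph "graph N"
  for N :: "'n :: {finite, linorder} plabic_data" +
  assumes disk: "compact (disk N)" "convex (disk N)" "interior (disk N) \<noteq> {}"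
    and segment: "\<exists>p q. p \<noteq> q \<and> closed_segment p q \<subseteq> frontier (disk N) \<and>
      range (bvert N) \<subseteq> closed_segment p q"
    and clockwise: "\<lbrakk>i < j; z \<in> interior (disk N)\<rbrakk> \<Longrightarrow>
      orient (bvert N j - bvert N i) (z - bvert N i) = -1"
    and bvert_in_verts: "bvert N j \<in> pverts (graph N)"
    and internal_inside: "internal N \<subseteq> interior (disk N)"
    and edges_meet: "\<lbrakk>e \<in> parcs (graph N); f \<in> parcs (graph N); e \<noteq> f\<rbrakk> \<Longrightarrow>
      edge_seg e \<inter> edge_seg f \<subseteq> {fst e, snd e} \<inter> {fst f, snd f}"
    and vertex_on_edge: "\<lbrakk>v \<in> pverts (graph N); e \<in> parcs (graph N); v \<in> edge_seg e\<rbrakk> \<Longrightarrow>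
      v = fst e \<or> v = snd e"
    and degree_boundary: "in_degree (graph N) (bvert N j) + out_degree (graph N) (bvert N j) = 1"
    and degree_internal: "v \<in> internal N \<Longrightarrow>
      in_degree (graph N) v + out_degree (graph N) v \<in> {2, 3}"
    and not_isolated: "v \<in> pverts (graph N) \<Longrightarrow>
      \<exists>j. v \<rightarrow>\<^sup>*\<^bsub>with_proj (mk_symmetric (graph N))\<^esub> bvert N j"
    and perfect_white: "\<lbrakk>v \<in> internal N; colour N v = White\<rbrakk> \<Longrightarrow> in_degree (graph N) v = 1"
    and perfect_black: "\<lbrakk>v \<in> internal N; colour N v = Black\<rbrakk> \<Longrightarrow> out_degree (graph N) v = 1"
    and weight_pos: "e \<in> parcs (graph N) \<Longrightarrow> weight N e > 0"

definition pivots :: "'n plabic_data \<Rightarrow> 'n set" where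
  "pivots N = {j. \<exists>e \<in> parcs (graph N). fst e = bvert N j}"

definition gauge_direction :: "'n plabic_data \<Rightarrow> complex \<Rightarrow> bool" where
  "gauge_direction N l \<longleftrightarrow> l \<noteq> 0 \<and>
    (\<forall>e \<in> parcs (graph N). orient l (edge_dir e) \<noteq> 0) \<and>
    (\<forall>j. (\<forall>\<^sub>F t in at_right 0. bvert N j + of_real t * l \<in> interior (disk N)) \<and>
         (\<forall>t\<ge>0. bvert N j + of_real t * l \<notin> internal N))"

text \<open>
  The intersection points of a gauge ray with an edge are counted by their ray parameter
  \<open>t\<close>; base points are excluded by \<open>t > 0\<close>.
\<close>

definition int_num :: "'n plabic_data \<Rightarrow> complex \<Rightarrow> complex \<times> complex \<Rightarrow> nat" where
  "int_num N l e = (\<Sum>i\<in>pivots N. card {t :: real. t > 0 \<and> bvert N i + of_real t * l \<in> edge_seg e})"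

definition wind :: "complex \<Rightarrow> complex \<times> complex \<Rightarrow> complex \<times> complex \<Rightarrow> int" where
  "wind l e f =
    (if orient (edge_dir e) (edge_dir f) = orient (edge_dir e) l \<and>
        orient (edge_dir e) l = orient l (edge_dir f)
     then orient (edge_dir e) (edge_dir f) else 0)"

definition solves_edge_equations ::
  "'n plabic_data \<Rightarrow> complex \<Rightarrow> ('n \<Rightarrow> 'v) \<Rightarrow> (complex \<times> complex \<Rightarrow> 'v :: real_vector) \<Rightarrow> bool" where
  "solves_edge_equations N l B E \<longleftrightarrow>
    (\<forall>e \<in> parcs (graph N). snd e \<in> internal N \<longrightarrow>
      E e = ((-1) ^ int_num N l e * weight N e) *\<^sub>R
        (\<Sum>f \<in> out_arcs (graph N) (snd e). ((-1) powi wind l e f) *\<^sub>R E f)) \<and>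
    (\<forall>e \<in> parcs (graph N). \<forall>j. j \<notin> pivots N \<and> snd e = bvert N j \<longrightarrow>
      E e = ((-1) ^ int_num N l e * weight N e) *\<^sub>R B j)"

text \<open>
  The system of edge vectors is the unique solution; only the values on the edges of
  the network matter.
\<close>

definition edge_vector_system ::
  "'n plabic_data \<Rightarrow> complex \<Rightarrow> ('n \<Rightarrow> 'v) \<Rightarrow> (complex \<times> complex \<Rightarrow> 'v :: real_vector) \<Rightarrow> bool" where
  "edge_vector_system N l B E \<longleftrightarrow> solves_edge_equations N l B E \<and>
    (\<forall>F. solves_edge_equations N l B F \<longrightarrow> (\<forall>e \<in> parcs (graph N). F e = E e))"

text \<open>A cycle is given by the list of its directed edges, as for \<^const>\<open>pre_digraph.cycle\<close>.\<close>

definition reverse_along ::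
  "(complex \<times> complex) list \<Rightarrow> 'n plabic_data \<Rightarrow> 'n plabic_data" where
  "reverse_along Q N = N\<lparr>
     graph := (graph N)\<lparr>parcs := (parcs (graph N) - set Q) \<union> prod.swap ` set Q\<rparr>,
     weight := (\<lambda>e. if prod.swap e \<in> set Q then 1 / weight N (prod.swap e) else weight N e)\<rparr>"

definition cycle_trace :: "(complex \<times> complex) list \<Rightarrow> complex set" where
  "cycle_trace Q = (\<Union>e \<in> set Q. edge_seg e)"

text \<open>
  The region marked \<open>-\<close> is \<^term>\<open>inside (cycle_trace Q)\<close>. In \<open>\<gamma>\<^sub>1\<close>, the points
  \<open>V - t d + \<epsilon> \<i> d\<close> with \<open>d\<close> the direction of \<open>e\<close> and \<open>V\<close> its ending point lie to the left
  of \<open>e\<close>, near \<open>V\<close>.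
\<close>

definition gamma1 :: "(complex \<times> complex) list \<Rightarrow> complex \<times> complex \<Rightarrow> int" where
  "gamma1 Q e =
    (if \<forall>\<^sub>F t in at_right 0. \<forall>\<^sub>F \<epsilon> in at_right 0.
          snd e - of_real t * edge_dir e + of_real \<epsilon> * \<i> * edge_dir e \<in> inside (cycle_trace Q)
     then 1 else 0)"

definition gamma2 :: "complex \<Rightarrow> complex \<times> complex \<Rightarrow> int" where
  "gamma2 l e = (1 - orient (edge_dir e) l) div 2"

definition gamma ::
  "'n plabic_data \<Rightarrow> complex \<Rightarrow> (complex \<times> complex) list \<Rightarrow> complex \<times> complex \<Rightarrow> int" where
  "gamma N l Q e =
    (if e \<in> set Q then gamma1 Q e + gamma2 l e + int (int_num N l e)
     else if fst e \<in> cycle_trace Q then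
       (if \<forall>\<^sub>F t in at_right 0. fst e + of_real t * edge_dir e \<in> inside (cycle_trace Q) then 1 else 0)
     else if fst e \<in> inside (cycle_trace Q) then 1 else 0)"

end

theory Submission
  imports Defs
begin

text \<open>
  Both linear systems split into the equations at the individual vertices. At each vertex
  the equations of the reversed network are linear combinations of the original ones, and vice
  versa. Hence the rescaling is a bijection between the solutions of the two systems, which
  gives uniqueness along with existence.

  Off the cycle \<open>Q\<close> the factors cancel because \<open>\<gamma>\<close> is the same for all edges at a vertex. At a
  vertex of \<open>Q\<close> everything reduces to parity identities between windings of two or three edges,
  in which \<open>\<gamma>\<close> records whether the third edge leaves into the sector to the left of \<open>Q\<close>. A
  direction is determined by its side of the gauge line and the cotangent of its angle to the
  gauge direction, so these identities become statements about the order of at most three reals.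

  By the Jordan curve theorem both sides of \<open>Q\<close> occur near each of its points, so the two sectors
  there lie in different regions. Consequently the region to the left of \<open>Q\<close> is locally constant
  along an edge and does not change at a vertex, which makes \<open>\<gamma>\<^sub>1\<close> constant on \<open>Q\<close>.
\<close>

section \<open>Signs of plane directions\<close>

definition cross :: "complex \<Rightarrow> complex \<Rightarrow> real" where
  "cross a b = Re a * Im b - Im a * Re b"

lemma orient_cross:
  "orient a b = (if cross a b > 0 then 1 else if cross a b < 0 then -1 else 0)"
  by (simp add: orient_def cross_def Let_def)

lemma orient_eq_iff:
  "orient a b = 1 \<longleftrightarrow> cross a b > 0"
  "orient a b = -1 \<longleftrightarrow> cross a b < 0"
  "orient a b = 0 \<longleftrightarrow> cross a b = 0"
  by (auto simp: orient_cross)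

lemma cross_simps:
  "cross a (- b) = - cross a b" "cross (- a) b = - cross a b"
  "cross a (b + c) = cross a b + cross a c" "cross (a + b) c = cross a c + cross b c"
  "cross a (of_real r * b) = r * cross a b" "cross (of_real r * a) b = r * cross a b"
  "cross a a = 0" "cross 0 a = 0" "cross a 0 = 0"
  by (simp_all add: cross_def algebra_simps)

lemma cross_swap: "cross b a = - cross a b"
  by (simp add: cross_def algebra_simps)

lemma orient_minus [simp]: "orient (- a) b = - orient a b" "orient a (- b) = - orient a b"
  by (auto simp: orient_cross cross_simps)

lemma orient_swap: "orient b a = - orient a b"
  using cross_swap[of a b] by (simp add: orient_cross)

text \<open>The open sector swept when turning counterclockwise from the direction \<open>a\<close> to \<open>b\<close>.\<close>

definition sector :: "complex \<Rightarrow> complex \<Rightarrow> complex set" where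
  "sector a b = {z. if orient a b = 1 then orient a z = 1 \<and> orient z b = 1
                    else orient a z = 1 \<or> orient z b = 1}"

definition same_ray :: "complex \<Rightarrow> complex \<Rightarrow> bool" where
  "same_ray a b \<longleftrightarrow> (\<exists>k>0. b = of_real k * a)"

text \<open>The cotangent of the angle from \<open>l\<close> to \<open>a\<close>.\<close>

definition cot_to :: "complex \<Rightarrow> complex \<Rightarrow> real" where
  "cot_to l a = (Re l * Re a + Im l * Im a) / cross l a"

lemma cot_to_minus [simp]: "cot_to l (- a) = cot_to l a"
proof -
  have "Re l * Re (-a) + Im l * Im (-a) = - (Re l * Re a + Im l * Im a)" by simp
  then show ?thesis unfolding cot_to_def cross_simps by (metis minus_divide_divide)
qed

text \<open>The identity |l|^2 * \<open>cross a b\<close> = \<open>cross l a\<close> *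
  \<open>cross l b\<close> * (\<open>cot_to l a\<close> - \<open>cot_to l b\<close>) carries the
  claim. It turns orientations of pairs into comparisons of reals.\<close>

lemma orient_via_cot:
  assumes "orient l a \<noteq> 0" "orient l b \<noteq> 0"
  shows "orient a b = orient l a * orient l b *
    (if cot_to l a > cot_to l b then 1 else if cot_to l a < cot_to l b then -1 else 0)"
proof -
  have nz: "cross l a \<noteq> 0" "cross l b \<noteq> 0" using assms by (metis orient_eq_iff(3))+
  define n where "n = (Re l)\<^sup>2 + (Im l)\<^sup>2"
  have "l \<noteq> 0" using nz by (auto simp: cross_simps)
  then have "n > 0" unfolding n_def using complex_neq_0 by blast
  have "n * cross a b = (Re l * Re a + Im l * Im a) * cross l b - (Re l * Re b + Im l * Im b) * cross l a"
    unfolding n_def cross_def by (simp add: algebra_simps power2_eq_square)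
  also have "\<dots> = cross l a * cross l b * (cot_to l a - cot_to l b)"
    using nz unfolding cot_to_def by (simp add: field_simps)
  finally have eq: "n * cross a b = cross l a * cross l b * (cot_to l a - cot_to l b)" .
  have "cross a b > 0 \<longleftrightarrow> cross l a * cross l b * (cot_to l a - cot_to l b) > 0"
    "cross a b < 0 \<longleftrightarrow> cross l a * cross l b * (cot_to l a - cot_to l b) < 0"
    using eq \<open>n > 0\<close> by (metis zero_less_mult_pos zero_less_mult_iff, metis mult_less_0_iff not_less_iff_gr_or_eq)
  then show ?thesis using nz
    by (auto simp: orient_cross zero_less_mult_iff mult_less_0_iff)
qed

text \<open>With k the quotient of the two cross products with \<open>l\<close>, the vector b - k a
  is both parallel and orthogonal to \<open>l\<close>, hence zero. Equal sides make k
  positive.\<close>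

lemma same_rayI:
  assumes "orient l a = orient l b" "orient l a \<noteq> 0" "cot_to l a = cot_to l b"
  shows "same_ray a b"
proof -
  have nz: "cross l a \<noteq> 0" "cross l b \<noteq> 0" using assms by (metis orient_eq_iff(3))+
  define k where "k = cross l b / cross l a"
  have k: "k > 0" using assms(1) nz unfolding k_def
    by (auto simp: orient_cross zero_less_divide_iff split: if_splits)
  have "l \<noteq> 0" using nz by (auto simp: cross_simps)
  then have n: "(Re l)\<^sup>2 + (Im l)\<^sup>2 > 0" using complex_neq_0 by blast
  define d where "d = b - of_real k * a"
  have "cross l d = 0"
    unfolding d_def diff_conv_add_uminus cross_simps using nz by (simp add: k_def)
  moreover have "Re l * Re d + Im l * Im d = 0"
  proof -
    have "Re l * Re b + Im l * Im b = k * (Re l * Re a + Im l * Im a)"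
      using assms(3) nz unfolding cot_to_def k_def by (simp add: field_simps)
    then show ?thesis by (simp add: d_def algebra_simps)
  qed
  ultimately have "((Re l)\<^sup>2 + (Im l)\<^sup>2) * Re d = 0" "((Re l)\<^sup>2 + (Im l)\<^sup>2) * Im d = 0"
    unfolding cross_def by algebra+
  then have "d = 0" using n by (auto simp: complex_eq_iff)
  then show ?thesis using k unfolding same_ray_def d_def by auto
qed

section \<open>Parities of windings at a vertex\<close>

definition turn :: "complex \<Rightarrow> complex \<Rightarrow> complex \<Rightarrow> int" where
  "turn l a b = (if orient a b = orient a l \<and> orient a l = orient l b then orient a b else 0)"

lemma orient_cases: "orient a b = 1 \<or> orient a b = -1 \<or> orient a b = 0"
  by (simp add: orient_cross)

text \<open>This is \<open>gamma2\<close> as a function of the direction alone, just as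
  \<open>turn\<close> is \<open>wind\<close>. Reversing an edge then amounts to negating its
  direction.\<close>

definition half_turn :: "complex \<Rightarrow> complex \<Rightarrow> int" where
  "half_turn l a = (1 - orient a l) div 2"

lemma even_half_turn:
  assumes "orient l a \<noteq> 0"
  shows "even (half_turn l a) \<longleftrightarrow> orient l a \<noteq> 1"
  using orient_cases[of l a] assms by (auto simp: half_turn_def orient_swap[of l a])

lemma orient_eq_1_via_cot:
  assumes "orient l a \<noteq> 0" "orient l b \<noteq> 0"
  shows "orient a b = 1 \<longleftrightarrow>
    (if orient l a = 1 \<longleftrightarrow> orient l b = 1 then cot_to l a > cot_to l b else cot_to l a < cot_to l b)"
  using orient_cases[of l a] orient_cases[of l b] assms
  unfolding orient_via_cot[OF assms] by auto

text \<open>A nonzero winding needs \<open>a\<close> and \<open>b\<close> on opposite sides of the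
  gauge line with \<open>l\<close>, rather than \<open>- l\<close>, in the cone between them. The
  comparison of cotangents decides which of the two it is.\<close>

lemma even_turn:
  assumes "orient l a \<noteq> 0" "orient l b \<noteq> 0"
  shows "even (turn l a b) \<longleftrightarrow> \<not> (orient l a \<noteq> 1 \<and> orient l b = 1 \<and> cot_to l a < cot_to l b) \<and>
    \<not> (orient l a = 1 \<and> orient l b \<noteq> 1 \<and> cot_to l b < cot_to l a)"
proof -
  consider "orient l a = 1" "orient l b = 1" | "orient l a = 1" "orient l b = -1"
    | "orient l a = -1" "orient l b = 1" | "orient l a = -1" "orient l b = -1"
    using orient_cases[of l a] orient_cases[of l b] assms by blast
  then show ?thesis
    by cases (simp_all add: turn_def orient_swap[of l a] orient_via_cot[OF assms])
qed

lemma orient_minus_eq_1_iff: "orient l a \<noteq> 0 \<Longrightarrow> orient l (- a) = 1 \<longleftrightarrow> orient l a \<noteq> 1"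
  using orient_cases[of l a] by auto

lemma cot_to_neq:
  assumes "\<not> same_ray a b" "orient l a \<noteq> 0" "orient l b \<noteq> 0"
  shows "\<not> ((orient l a = 1 \<longleftrightarrow> orient l b = 1) \<and> cot_to l a = cot_to l b)"
  using same_rayI[of l a b] assms orient_cases[of l a] orient_cases[of l b] by metis

text \<open>If \<open>a\<close> and \<open>b\<close> lie on the same side of the gauge line, both
  turns vanish and the half turns agree. Otherwise the half turns differ, and exactly one of
  \<open>l\<close> and \<open>- l\<close> lies in the cone of \<open>a\<close> and \<open>b\<close>,
  so exactly one turn is odd. Excluding backtracking keeps that cone from degenerating.\<close>

lemma parity_through:
  assumes "orient l a \<noteq> 0" "orient l b \<noteq> 0" "\<not> same_ray b (- a)"
  shows "even (half_turn l a + half_turn l b + turn l a b + turn l (- b) (- a))"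
proof -
  have nz: "orient l (- a) \<noteq> 0" "orient l (- b) \<noteq> 0" using assms by auto
  have ne: "\<not> ((orient l b = 1 \<longleftrightarrow> orient l a \<noteq> 1) \<and> cot_to l b = cot_to l a)"
    using cot_to_neq[OF assms(3,2) nz(1)] orient_minus_eq_1_iff[OF assms(1)] by simp
  show ?thesis
    using ne unfolding even_add even_half_turn[OF assms(1)] even_half_turn[OF assms(2)]
      even_turn[OF assms(1,2)] even_turn[OF nz(2,1)] cot_to_minus
      orient_minus_eq_1_iff[OF assms(1)] orient_minus_eq_1_iff[OF assms(2)] by (smt (verit))
qed

text \<open>The path enters a vertex along \<open>a\<close> and leaves along \<open>b\<close>, and a
  third edge enters along \<open>c\<close>. The sector from \<open>b\<close> to \<open>- a\<close>
  is the one to the left of the path. After reversal the outgoing direction is \<open>- a\<close>,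
  whence the last turn.\<close>

lemma parity_join:
  assumes "orient l a \<noteq> 0" "orient l b \<noteq> 0" "orient l c \<noteq> 0"
    and "\<not> same_ray b (- a)" "\<not> same_ray b (- c)" "\<not> same_ray (- a) (- c)"
  shows "odd (half_turn l a + turn l a b + turn l c b + turn l c (- a)) \<longleftrightarrow> - c \<notin> sector b (- a)"
proof -
  have nz: "orient l (- a) \<noteq> 0" "orient l (- c) \<noteq> 0" using assms by auto
  \<comment> \<open>The outward directions \<open>b\<close>, \<open>- a\<close>, \<open>- c\<close>
    lie on three different rays, so two of them on the same side of the gauge line have different
    cotangents. What remains is a case distinction over sides and the order of three reals.\<close>
  have ne: "\<not> ((orient l b = 1 \<longleftrightarrow> orient l a \<noteq> 1) \<and> cot_to l b = cot_to l a)"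
     "\<not> ((orient l b = 1 \<longleftrightarrow> orient l c \<noteq> 1) \<and> cot_to l b = cot_to l c)"
     "\<not> ((orient l a = 1 \<longleftrightarrow> orient l c = 1) \<and> cot_to l a = cot_to l c)"
    using cot_to_neq[OF assms(4,2) nz(1)] cot_to_neq[OF assms(5,2) nz(2)] cot_to_neq[OF assms(6) nz]
      orient_minus_eq_1_iff[OF assms(1)] orient_minus_eq_1_iff[OF assms(3)]
    unfolding cot_to_minus by satx+
  show ?thesis
    using ne unfolding even_add even_half_turn[OF assms(1)]
      even_turn[OF assms(1,2)] even_turn[OF assms(3,2)] even_turn[OF assms(3) nz(1)] cot_to_minus
      sector_def mem_Collect_eq
      orient_eq_1_via_cot[OF assms(2) nz(1)] orient_eq_1_via_cot[OF assms(2) nz(2)]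
      orient_eq_1_via_cot[OF nz(2,1)]
      orient_minus_eq_1_iff[OF assms(1)] orient_minus_eq_1_iff[OF assms(3)]
    by (smt (verit))
qed

text \<open>The counterpart of \<open>parity_join\<close> for a third edge that leaves along
  \<open>c\<close>. After reversal the path enters along \<open>- b\<close>, and both
  \<open>- a\<close> and \<open>c\<close> leave.\<close>

lemma parity_split:
  assumes "orient l a \<noteq> 0" "orient l b \<noteq> 0" "orient l c \<noteq> 0"
    and "\<not> same_ray b (- a)" "\<not> same_ray b c" "\<not> same_ray (- a) c"
  shows "odd (half_turn l a + turn l a c + turn l (- b) c + turn l (- b) (- a)) \<longleftrightarrow> c \<in> sector b (- a)"
proof -
  have nz: "orient l (- a) \<noteq> 0" "orient l (- b) \<noteq> 0" using assms by auto
  have ne: "\<not> ((orient l b = 1 \<longleftrightarrow> orient l a \<noteq> 1) \<and> cot_to l b = cot_to l a)"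
     "\<not> ((orient l b = 1 \<longleftrightarrow> orient l c = 1) \<and> cot_to l b = cot_to l c)"
     "\<not> ((orient l a = 1 \<longleftrightarrow> orient l c \<noteq> 1) \<and> cot_to l a = cot_to l c)"
    using cot_to_neq[OF assms(4,2) nz(1)] cot_to_neq[OF assms(5,2,3)] cot_to_neq[OF assms(6) nz(1) assms(3)]
      orient_minus_eq_1_iff[OF assms(1)]
    unfolding cot_to_minus by satx+
  show ?thesis
    using ne unfolding even_add even_half_turn[OF assms(1)]
      even_turn[OF assms(1,3)] even_turn[OF nz(2) assms(3)] even_turn[OF nz(2,1)] cot_to_minus
      sector_def mem_Collect_eq
      orient_eq_1_via_cot[OF assms(2) nz(1)] orient_eq_1_via_cot[OF assms(2,3)]
      orient_eq_1_via_cot[OF assms(3) nz(1)]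
      orient_minus_eq_1_iff[OF assms(1)] orient_minus_eq_1_iff[OF assms(2)]
    by (smt (verit))
qed

section \<open>Polygons near a point\<close>

lemma same_ray_sym: "same_ray a b \<Longrightarrow> same_ray b a"
  unfolding same_ray_def by (metis divide_pos_pos mult.assoc mult.left_neutral nonzero_divide_eq_eq
      of_real_1 of_real_mult order_less_irrefl zero_less_one)

lemma cross_eq_0_collinear:
  assumes "cross a b = 0" "a \<noteq> 0"
  obtains k where "b = of_real k * a"
proof -
  define n where "n = (Re a)\<^sup>2 + (Im a)\<^sup>2"
  define k where "k = (Re a * Re b + Im a * Im b) / n"
  have "n \<noteq> 0" unfolding n_def using assms(2) complex_neq_0[of a] by (metis less_irrefl)
  moreover have "Re b * n = (Re a * Re b + Im a * Im b) * Re a"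
    "Im b * n = (Re a * Re b + Im a * Im b) * Im a"
    using assms(1) unfolding cross_def n_def by algebra+
  ultimately have "Re b = (Re a * Re b + Im a * Im b) * Re a / n"
    "Im b = (Re a * Re b + Im a * Im b) * Im a / n"
    by (metis nonzero_eq_divide_eq)+
  then have "b = of_real k * a" unfolding k_def by (simp add: complex_eq_iff)
  then show ?thesis using that by blast
qed

lemma opposite_rays:
  assumes "cross a b = 0" "a \<noteq> 0" "b \<noteq> 0" "\<not> same_ray a b"
  obtains k where "k > 0" "b = of_real (- k) * a"
proof -
  obtain k where k: "b = of_real k * a" using cross_eq_0_collinear assms by blast
  then have "\<not> k > 0" "k \<noteq> 0" using assms unfolding same_ray_def by auto
  then show ?thesis using that[of "-k"] k by auto
qed

section \<open>The two sectors between two rays\<close>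

lemma mem_sector_iff:
  "z \<in> sector a b \<longleftrightarrow> (if cross a b > 0 then cross a z > 0 \<and> cross z b > 0
     else cross a z > 0 \<or> cross z b > 0)"
  by (simp add: sector_def orient_eq_iff)

lemma sector_avoids_rays:
  assumes "z \<in> sector a b"
  shows "z \<noteq> 0" "\<not> same_ray a z" "\<not> same_ray b z"
  using assms cross_swap[of a b]
  by (auto simp: mem_sector_iff same_ray_def cross_simps zero_less_mult_iff mult_less_0_iff split: if_splits)

lemma sector_scale: "t > 0 \<Longrightarrow> of_real t * z \<in> sector a b \<longleftrightarrow> z \<in> sector a b"
  by (simp add: mem_sector_iff cross_simps zero_less_mult_iff)

text \<open>When one sector is convex, a point missed by both satisfies opposite weak inequalities
  and hence lies on the line of \<open>a\<close> or of \<open>b\<close>; the sign of its coefficient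
  puts it on the ray itself. Opposite rays leave two open half-planes and are treated apart.\<close>

lemma sectors_cover:
  assumes "a \<noteq> 0" "b \<noteq> 0" "\<not> same_ray a b" "z \<noteq> 0" "\<not> same_ray a z" "\<not> same_ray b z"
  shows "z \<in> sector a b \<union> sector b a"
proof -
  have *: "z \<in> sector a b \<union> sector b a"
    if ab: "cross a b > 0" and nr: "\<not> same_ray a z" "\<not> same_ray b z" for a b
  proof (rule ccontr)
    assume "\<not> ?thesis"
    then have c: "cross a z \<le> 0 \<or> cross z b \<le> 0" "cross b z \<le> 0" "cross z a \<le> 0"
      using ab cross_swap[of a b] by (auto simp: mem_sector_iff)
    have nz: "a \<noteq> 0" "b \<noteq> 0" using ab by (auto simp: cross_simps)
    consider "cross a z = 0" | "cross b z = 0"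
      using c cross_swap[of a z] cross_swap[of b z] by linarith
    then show False
    proof cases
      case 1
      then obtain k where k: "z = of_real k * a" using cross_eq_0_collinear nz by blast
      then have "k * cross a b \<ge> 0" using c(2) cross_swap[of a b] by (simp add: cross_simps)
      then have "k > 0" using ab k \<open>z \<noteq> 0\<close> by (auto simp: zero_le_mult_iff)
      then show False using nr k unfolding same_ray_def by blast
    next
      case 2
      then obtain k where k: "z = of_real k * b" using cross_eq_0_collinear nz by blast
      then have "k * cross a b \<ge> 0" using c(3) cross_swap[of a b] by (simp add: cross_simps)
      then have "k > 0" using ab k \<open>z \<noteq> 0\<close> by (auto simp: zero_le_mult_iff)
      then show False using nr k unfolding same_ray_def by blast
    qed
  qed
  consider "cross a b > 0" | "cross b a > 0" | "cross a b = 0"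
    using cross_swap[of a b] by linarith
  then show ?thesis
  proof cases
    case 3
    then obtain k where k: "k > 0" "b = of_real (- k) * a" using opposite_rays assms by blast
    show ?thesis
    proof (cases "cross a z = 0")
      case True
      then obtain m where m: "z = of_real m * a" using cross_eq_0_collinear assms by blast
      then have "m > 0 \<or> m < 0" using assms by fastforce
      then show ?thesis
      proof
        assume "m < 0"
        then have "z = of_real (m / - k) * b" "m / - k > 0" using m k \<open>m < 0\<close>
          by (simp_all add: divide_neg_pos)
        then show ?thesis using assms unfolding same_ray_def by blast
      qed (use assms m same_ray_def in blast)
    next
      case False
      then show ?thesis using 3 k cross_swap[of a b]
        by (auto simp: mem_sector_iff cross_simps mult_less_0_iff)
    qed
  qed (use *[of a b] *[of b a] assms in auto)
qed

lemma convex_cross_pos: "convex {z. cross c z > 0}"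
proof -
  have "{z. cross c z > 0} = {z. inner (Complex (- Im c) (Re c)) z > 0}"
    by (simp add: cross_def inner_complex_def)
  then show ?thesis by (simp add: convex_halfspace_gt)
qed

text \<open>A convex sector is an intersection of two half-planes. A straight or reflex one is their
  union, which is connected within the ball once the two half-disks share a point.\<close>

lemma connected_sector:
  assumes "a \<noteq> 0" "b \<noteq> 0" "\<not> same_ray a b" "r > 0"
  shows "Topological_Spaces.connected (sector a b \<inter> ball 0 r)"
proof -
  have H: "convex ({z. cross a z > 0} \<inter> ball 0 r)" "convex ({z. cross (- b) z > 0} \<inter> ball 0 r)"
    by (intro convex_Int convex_cross_pos convex_ball)+
  have b: "cross (- b) z = cross z b" for z using cross_swap[of z b] by (simp add: cross_simps)
  show ?thesis
  proof (cases "cross a b > 0")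
    case True
    then have "sector a b \<inter> ball 0 r = {z. cross a z > 0} \<inter> ball 0 r \<inter> ({z. cross (- b) z > 0} \<inter> ball 0 r)"
      unfolding b by (auto simp: mem_sector_iff)
    then show ?thesis using H by (metis convex_Int convex_connected)
  next
    case False
    \<comment> \<open>For a straight angle the two half-planes coincide and contain
      \<open>\<i> * a\<close>. For a reflex angle the vector - a - b lies in both.\<close>
    have "\<exists>z. cross a z > 0 \<and> cross z b > 0"
    proof (cases "cross a b = 0")
      case True
      then obtain k where k: "k > 0" "b = of_real (- k) * a" using opposite_rays assms by blast
      have "cross a (\<i> * a) > 0" using assms(1) complex_neq_0[of a]
        by (simp add: cross_def power2_eq_square)
      then show ?thesis using k cross_swap[of a "\<i> * a"]
        by (intro exI[of _ "\<i> * a"]) (simp add: cross_simps mult_less_0_iff)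
    next
      case n: False
      then show ?thesis using False
        by (intro exI[of _ "(- a) + (- b)"]) (simp only: cross_simps, linarith)
    qed
    then obtain z where z: "cross a z > 0" "cross z b > 0" by blast
    \<comment> \<open>Both half-planes are cones, so the witness may be shrunk into the
      ball.\<close>
    define t where "t = r / (2 * (norm z + 1))"
    have "t > 0" using assms(4) unfolding t_def by (simp add: add_nonneg_pos)
    have "t * norm z < r"
    proof -
      have "norm z < 2 * (norm z + 1)" using add_nonneg_pos[of "norm z" 2] by (simp add: distrib_left)
      then have "t * norm z < t * (2 * (norm z + 1))" using \<open>t > 0\<close> by simp
      also have "\<dots> = r"
        unfolding t_def by (rule nonzero_eq_divide_eq[THEN iffD1, OF _ refl]) (use \<open>norm z < 2 * (norm z + 1)\<close> norm_ge_zero[of z] in \<open>metis not_less\<close>)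
      finally show ?thesis .
    qed
    then have "of_real t * z \<in> ({z. cross a z > 0} \<inter> ball 0 r) \<inter> ({z. cross (- b) z > 0} \<inter> ball 0 r)"
      using z \<open>t > 0\<close> unfolding b by (simp add: norm_mult cross_simps)
    moreover have "sector a b \<inter> ball 0 r = ({z. cross a z > 0} \<inter> ball 0 r) \<union> ({z. cross (- b) z > 0} \<inter> ball 0 r)"
      using False unfolding b by (auto simp: mem_sector_iff)
    ultimately show ?thesis using H by (metis connected_Un convex_connected empty_iff)
  qed
qed

lemma connected_inside_or_not:
  fixes S :: "complex set"
  assumes "closed S" "Topological_Spaces.connected X" "X \<inter> S = {}"
  shows "X \<subseteq> inside S \<or> X \<inter> inside S = {}"
proof -
  have "X \<subseteq> inside S \<union> outside S" using assms(3) by (auto simp: inside_outside)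
  then show ?thesis
    using connectedD[OF assms(2) open_inside[OF assms(1)] open_outside[OF assms(1)]]
      inside_Int_outside[of S] by blast
qed

text \<open>Each sector, cut off at radius \<open>r\<close>, is connected and misses
  \<open>S\<close>, so it lies on one side only. As \<open>v\<close> is in the frontier of both
  \<open>inside S\<close> and \<open>outside S\<close>, both sides occur within radius
  \<open>r\<close>, and the two sectors cannot lie on the same side.\<close>

lemma sectors_on_different_sides:
  assumes "closed S" "frontier (inside S) = S" "frontier (outside S) = S"
    and "a \<noteq> 0" "b \<noteq> 0" "\<not> same_ray a b" "r > 0"
    and loc: "\<And>z. norm z < r \<Longrightarrow> v + z \<in> S \<longleftrightarrow> z = 0 \<or> same_ray a z \<or> same_ray b z"
  shows "(\<forall>z \<in> sector a b. norm z < r \<longrightarrow> v + z \<in> inside S) \<and>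
      (\<forall>z \<in> sector b a. norm z < r \<longrightarrow> v + z \<notin> inside S) \<or>
    (\<forall>z \<in> sector a b. norm z < r \<longrightarrow> v + z \<notin> inside S) \<and>
      (\<forall>z \<in> sector b a. norm z < r \<longrightarrow> v + z \<in> inside S)"
proof -
  have side: "(\<forall>z \<in> sector a b. norm z < r \<longrightarrow> v + z \<in> inside S) \<or>
      (\<forall>z \<in> sector a b. norm z < r \<longrightarrow> v + z \<notin> inside S)"
    if "a \<noteq> 0" "b \<noteq> 0" "\<not> same_ray a b"
      "\<And>z. norm z < r \<Longrightarrow> v + z \<in> S \<longleftrightarrow> z = 0 \<or> same_ray a z \<or> same_ray b z" for a b
  proof -
    let ?X = "(+) v ` (sector a b \<inter> ball 0 r)"
    have "?X \<inter> S = {}" using that(4) sector_avoids_rays[of _ a b] by auto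
    moreover have "Topological_Spaces.connected ?X"
      using connected_sector[OF that(1-3) \<open>r > 0\<close>] by (intro connected_continuous_image continuous_intros)
    ultimately have "?X \<subseteq> inside S \<or> ?X \<inter> inside S = {}"
      using connected_inside_or_not[OF \<open>closed S\<close>] by blast
    moreover have "v + z \<in> ?X" if "z \<in> sector a b" "norm z < r" for z
      using that by simp
    ultimately show ?thesis by blast
  qed
  have cover: "z \<in> sector a b \<union> sector b a" if "norm z < r" "v + z \<notin> S" for z
    using that loc[of z] sectors_cover[OF assms(4-6)] by blast
  have "v \<in> S" using loc[of 0] \<open>r > 0\<close> by simp
  have meets: "\<exists>z. norm z < r \<and> v + z \<in> A" if "frontier A = S" for A
  proof -
    have "v \<in> closure A" using that \<open>v \<in> S\<close> by (auto simp: frontier_def)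
    then obtain y where "y \<in> A" "dist y v < r" using \<open>r > 0\<close> closure_approachable by blast
    then show ?thesis by (intro exI[of _ "y - v"]) (simp add: dist_norm)
  qed
  obtain x where x: "norm x < r" "v + x \<in> inside S" using meets assms(2) by blast
  obtain y where y: "norm y < r" "v + y \<in> outside S" using meets assms(3) by blast
  have "v + x \<notin> S" "v + y \<notin> S" "v + y \<notin> inside S"
    using x y inside_no_overlap[of S] outside_no_overlap[of S] inside_Int_outside[of S] by blast+
  then have "x \<in> sector a b \<union> sector b a" "y \<in> sector a b \<union> sector b a"
    using cover x y by blast+
  moreover have "\<not> same_ray b a" using same_ray_sym assms(6) by blast
  then have "(\<forall>z \<in> sector b a. norm z < r \<longrightarrow> v + z \<in> inside S) \<or>
      (\<forall>z \<in> sector b a. norm z < r \<longrightarrow> v + z \<notin> inside S)"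
    using side[of b a] assms(4,5) loc by blast
  ultimately show ?thesis using side[OF assms(4-6) loc] x y \<open>v + y \<notin> inside S\<close> by blast
qed

section \<open>Segments near a point and polygonal arcs\<close>

lemma segments_same_ray:
  assumes "closed_segment p (p + a) \<inter> closed_segment p (p + b) \<subseteq> {p, p + a}" "a \<noteq> 0"
  shows "\<not> same_ray a b"
proof
  assume "same_ray a b"
  then obtain k where k: "k > 0" "b = of_real k * a" unfolding same_ray_def by blast
  \<comment> \<open>Below both 1 and \<open>k\<close>, so that p + t a lies on both segments without
    being an end of the first.\<close>
  define t where "t = min 1 k / 2"
  have t: "0 < t" "t < 1" "t \<le> k" using k unfolding t_def by auto
  have "p + of_real t * a \<in> closed_segment p (p + a)"
    unfolding in_segment using t by (intro exI[of _ t]) (simp add: scaleR_conv_of_real algebra_simps)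
  moreover have "p + of_real t * a \<in> closed_segment p (p + b)"
    unfolding in_segment using t k
    by (intro exI[of _ "t / k"]) (simp add: scaleR_conv_of_real field_simps)
  ultimately have "p + of_real t * a \<in> {p, p + a}" using assms by blast
  then show False using t assms(2) by auto
qed

lemma mem_segment_near_start:
  assumes "norm z < norm a"
  shows "p + z \<in> closed_segment p (p + a) \<longleftrightarrow> z = 0 \<or> same_ray a z"
proof
  assume "p + z \<in> closed_segment p (p + a)"
  then obtain u where u: "0 \<le> u" "p + z = (1 - u) *\<^sub>R p + u *\<^sub>R (p + a)"
    unfolding in_segment by blast
  then have "z = of_real u * a" by (simp add: scaleR_conv_of_real algebra_simps)
  then show "z = 0 \<or> same_ray a z" using u(1) unfolding same_ray_def
    by (metis less_eq_real_def mult_zero_left of_real_0)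
next
  assume "z = 0 \<or> same_ray a z"
  then show "p + z \<in> closed_segment p (p + a)"
  proof
    assume "same_ray a z"
    then obtain k where k: "k > 0" "z = of_real k * a" unfolding same_ray_def by blast
    then have "k * norm a < 1 * norm a" using assms by (simp add: norm_mult)
    then have "k < 1" by (metis mult_right_mono norm_ge_zero not_less)
    then show ?thesis unfolding in_segment using k
      by (intro exI[of _ k]) (simp add: scaleR_conv_of_real algebra_simps)
  qed simp
qed

text \<open>The finitely many segments that avoid \<open>p\<close> have a closed union, which keeps
  a positive distance from \<open>p\<close>.\<close>

lemma locally_only_segments_through:
  assumes "finite A"
  obtains r where "r > 0"
    "\<And>z. norm z < r \<Longrightarrow> p + z \<in> (\<Union>e\<in>A. edge_seg e) \<longleftrightarrow> (\<exists>e\<in>A. p \<in> edge_seg e \<and> p + z \<in> edge_seg e)"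
proof -
  have "closed (\<Union>e\<in>{e\<in>A. p \<notin> edge_seg e}. edge_seg e)"
    using assms by (intro closed_UN) (auto simp: edge_seg_def)
  then have "open (- (\<Union>e\<in>{e\<in>A. p \<notin> edge_seg e}. edge_seg e))" by (rule open_Compl)
  moreover have "p \<in> - (\<Union>e\<in>{e\<in>A. p \<notin> edge_seg e}. edge_seg e)" by blast
  ultimately obtain r where r: "r > 0" "ball p r \<subseteq> - (\<Union>e\<in>{e\<in>A. p \<notin> edge_seg e}. edge_seg e)"
    by (rule openE)
  have "p + z \<in> (\<Union>e\<in>A. edge_seg e) \<longleftrightarrow> (\<exists>e\<in>A. p \<in> edge_seg e \<and> p + z \<in> edge_seg e)"
    if "norm z < r" for z
  proof -
    have "p + z \<in> ball p r" using that by (simp add: dist_norm)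
    then show ?thesis using r by blast
  qed
  then show ?thesis using that r(1) by blast
qed

text \<open>Serves the vertices of a polygon as well as the inner points of a side, where
  \<open>a\<close> and \<open>b\<close> point to the two ends of that side.\<close>

lemma locally_two_rays:
  assumes "finite A" "a \<noteq> 0" "b \<noteq> 0"
    and "\<And>x. (\<exists>e\<in>A. p \<in> edge_seg e \<and> x \<in> edge_seg e) \<longleftrightarrow>
      x \<in> closed_segment p (p + a) \<union> closed_segment p (p + b)"
  obtains r where "r > 0"
    "\<And>z. norm z < r \<Longrightarrow> p + z \<in> (\<Union>e\<in>A. edge_seg e) \<longleftrightarrow> z = 0 \<or> same_ray a z \<or> same_ray b z"
proof -
  obtain r where r: "r > 0" "\<And>z. norm z < r \<Longrightarrow>
      p + z \<in> (\<Union>e\<in>A. edge_seg e) \<longleftrightarrow> (\<exists>e\<in>A. p \<in> edge_seg e \<and> p + z \<in> edge_seg e)"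
    using locally_only_segments_through[OF assms(1)] by metis
  show ?thesis
  proof (rule that)
    show "min r (min (norm a) (norm b)) > 0" using r(1) assms by simp
    show "p + z \<in> (\<Union>e\<in>A. edge_seg e) \<longleftrightarrow> z = 0 \<or> same_ray a z \<or> same_ray b z"
      if "norm z < min r (min (norm a) (norm b))" for z
      using r(2)[of z] assms(4)[of "p + z"] mem_segment_near_start[of z a p]
        mem_segment_near_start[of z b p] that by auto
  qed
qed

text \<open>The segments are joined one by one, from the last to the first. Including
  \<open>u\<close> in the distinctness condition keeps the first segment from meeting the rest
  anywhere but at its end.\<close>

lemma arc_polyline:
  assumes "pcas u es v" "es \<noteq> []" "distinct (u # map snd es)"
    and "\<And>e f. e \<in> set es \<Longrightarrow> f \<in> set es \<Longrightarrow> e \<noteq> f \<Longrightarrow>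
      edge_seg e \<inter> edge_seg f \<subseteq> {fst e, snd e} \<inter> {fst f, snd f}"
  shows "\<exists>g. arc g \<and> path_image g = cycle_trace es \<and> pathstart g = u \<and> pathfinish g = v"
  using assms
proof (induction es arbitrary: u)
  case (Cons e es)
  have e: "fst e = u" "pcas (snd e) es v" "u \<noteq> snd e" using Cons.prems by auto
  have lp: "arc (linepath u (snd e))" "path_image (linepath u (snd e)) = edge_seg e"
    using e by (auto simp: edge_seg_def)
  show ?case
  proof (cases "es = []")
    case True
    then show ?thesis using lp e
      by (intro exI[of _ "linepath u (snd e)"]) (auto simp: cycle_trace_def)
  next
    case False
    have "\<exists>g. arc g \<and> path_image g = cycle_trace es \<and> pathstart g = snd e \<and> pathfinish g = v"
      using Cons.prems(3,4) by (intro Cons.IH[OF e(2) False]) auto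
    then obtain g where g: "arc g" "path_image g = cycle_trace es" "pathstart g = snd e" "pathfinish g = v"
      by blast
    \<comment> \<open>Every edge of a walk starts at the start of the walk or at the end of one of
      its edges. Hence \<open>u\<close> is no endpoint of a later edge.\<close>
    have fsts: "fst f \<in> insert w (set (map snd es'))" if "pcas w es' v" "f \<in> set es'" for w es' f
      using that by (induction es' arbitrary: w) auto
    have "x = snd e" if "x \<in> edge_seg e" "x \<in> edge_seg f" "f \<in> set es" for x f
    proof -
      have "f \<noteq> e" using that(3) Cons.prems(3) by auto
      then have x: "x \<in> {fst e, snd e} \<inter> {fst f, snd f}"
        using Cons.prems(4)[of e f] that by auto
      have "u \<noteq> snd f" "u \<noteq> fst f"
        using fsts[OF e(2) that(3)] Cons.prems(3) that(3) by auto
      then show ?thesis using x e by auto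
    qed
    then have "arc (linepath u (snd e) +++ g)"
      using lp g by (intro arc_join) (auto simp: cycle_trace_def)
    then show ?thesis using g lp
      by (intro exI[of _ "linepath u (snd e) +++ g"]) (auto simp: path_image_join cycle_trace_def)
  qed
qed simp

lemma cross_i: "cross d (\<i> * d) = (norm d)\<^sup>2"
  by (simp add: cross_def cmod_power2) (simp add: power2_eq_square)

lemma eventually_small: "r > 0 \<Longrightarrow> \<forall>\<^sub>F t in at_right 0. 0 < t \<and> t < (r::real)"
  by (simp add: eventually_at_right_less eventually_conj eventually_at_right_field) (auto intro!: exI[of _ r])

lemma eventually_pos:
  fixes a b :: real
  assumes "a > 0"
  shows "\<forall>\<^sub>F \<epsilon> in at_right 0. a + \<epsilon> * b > 0"
proof -
  have "((\<lambda>\<epsilon>. a + \<epsilon> * b) \<longlongrightarrow> a + 0 * b) (at_right 0)" by (intro tendsto_intros)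
  then show ?thesis using assms order_tendstoD(1) by fastforce
qed

section \<open>Regions of a simple closed polygon\<close>

locale simple_polygon =
  fixes Q :: "(complex \<times> complex) list" and u :: complex
  assumes closed_walk: "pcas u Q u" and nonempty: "Q \<noteq> []"
    and distinct_ends: "distinct (map snd Q)"
    and loopless: "e \<in> set Q \<Longrightarrow> fst e \<noteq> snd e"
    and sides_meet: "\<lbrakk>e \<in> set Q; f \<in> set Q; e \<noteq> f\<rbrakk> \<Longrightarrow>
      edge_seg e \<inter> edge_seg f \<subseteq> {fst e, snd e} \<inter> {fst f, snd f}"
begin

text \<open>Cancelling \<open>u\<close> shows that starts and ends form the same multiset. This
  transfers distinctness from the ends to the starts.\<close>

lemma starts_ends: "map fst Q @ [u] = u # map snd Q"
proof -
  have "map fst es @ [v] = w # map snd es" if "pcas w es v" for w v and es :: "(complex \<times> complex) list"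
    using that by (induction es arbitrary: w) auto
  then show ?thesis using closed_walk by blast
qed

lemma mset_starts: "mset (map fst Q) = mset (map snd Q)"
  using arg_cong[OF starts_ends, of mset] by simp

lemma distinct_starts: "distinct (map fst Q)"
  using distinct_ends mset_eq_imp_distinct_iff[OF mset_starts] by blast

lemma fst_set: "fst ` set Q = snd ` set Q"
  using mset_eq_setD[OF mset_starts] by simp

lemma start_inj: "\<lbrakk>e \<in> set Q; f \<in> set Q; fst e = fst f\<rbrakk> \<Longrightarrow> e = f"
  using distinct_starts by (auto simp: distinct_map dest: inj_onD)

lemma end_inj: "\<lbrakk>e \<in> set Q; f \<in> set Q; snd e = snd f\<rbrakk> \<Longrightarrow> e = f"
  using distinct_ends by (auto simp: distinct_map dest: inj_onD)

lemma trace_closed: "closed (cycle_trace Q)"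
  unfolding cycle_trace_def by (intro closed_UN) (auto simp: edge_seg_def)

text \<open>Without its first side the polygon is an arc from the end of that side back to
  \<open>u\<close>. The side meets this arc only in its own two endpoints, so joining them gives a
  simple loop.\<close>

lemma simple_closed_path:
  "\<exists>g. simple_path g \<and> pathfinish g = pathstart g \<and> path_image g = cycle_trace Q"
proof -
  obtain e es where Q: "Q = e # es" using nonempty by (cases Q) auto
  have e: "fst e = u" "pcas (snd e) es u" "u \<noteq> snd e"
    using closed_walk loopless[of e] unfolding Q by auto
  then have "es \<noteq> []" by auto
  then have "\<exists>g. arc g \<and> path_image g = cycle_trace es \<and> pathstart g = snd e \<and> pathfinish g = u"
    using distinct_ends sides_meet unfolding Q by (intro arc_polyline e(2)) auto
  then obtain g where g: "arc g" "path_image g = cycle_trace es" "pathstart g = snd e" "pathfinish g = u"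
    by blast
  have lp: "arc (linepath u (snd e))" "path_image (linepath u (snd e)) = edge_seg e"
    using e by (auto simp: edge_seg_def)
  have "edge_seg e \<inter> edge_seg f \<subseteq> {u, snd e}" if "f \<in> set es" for f
  proof -
    have "f \<noteq> e" using that distinct_ends unfolding Q by auto
    then show ?thesis using sides_meet[of e f] that e unfolding Q by auto
  qed
  then have "simple_path (linepath u (snd e) +++ g)"
    using lp g by (intro simple_path_join_loop) (auto simp: cycle_trace_def)
  then show ?thesis using g lp
    by (intro exI[of _ "linepath u (snd e) +++ g"]) (auto simp: path_image_join cycle_trace_def Q)
qed

lemma frontier_inside: "frontier (inside (cycle_trace Q)) = cycle_trace Q"
  and frontier_outside: "frontier (outside (cycle_trace Q)) = cycle_trace Q"
  using simple_closed_path Jordan_inside_outside by metis+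

text \<open>The Jordan curve theorem supplies the frontier conditions. The truth value
  \<open>L\<close> records which of the two sectors is the inner one.\<close>

lemma two_rays_sides:
  assumes "a \<noteq> 0" "b \<noteq> 0" "\<not> same_ray a b"
    and "\<And>x. (\<exists>e\<in>set Q. p \<in> edge_seg e \<and> x \<in> edge_seg e) \<longleftrightarrow>
      x \<in> closed_segment p (p + a) \<union> closed_segment p (p + b)"
  obtains r L where "r > 0"
    "\<And>z. z \<in> sector a b \<Longrightarrow> norm z < r \<Longrightarrow> p + z \<in> inside (cycle_trace Q) \<longleftrightarrow> L"
    "\<And>z. z \<in> sector b a \<Longrightarrow> norm z < r \<Longrightarrow> p + z \<in> inside (cycle_trace Q) \<longleftrightarrow> \<not> L"
proof -
  obtain r where r: "r > 0" "\<And>z. norm z < r \<Longrightarrow>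
      p + z \<in> cycle_trace Q \<longleftrightarrow> z = 0 \<or> same_ray a z \<or> same_ray b z"
    using locally_two_rays[OF finite_set assms(1,2,4)] unfolding cycle_trace_def by metis
  show ?thesis
    using sectors_on_different_sides[OF trace_closed frontier_inside frontier_outside assms(1-3) r]
      that[OF r(1), of True] that[OF r(1), of False] by blast
qed

text \<open>At s = 1 - t this is the inner condition of \<open>gamma1\<close>. Admitting all
  parameters allows the left side to be followed from one end of \<open>e\<close> to the
  other.\<close>

definition left_inside :: "complex \<times> complex \<Rightarrow> real \<Rightarrow> bool" where
  "left_inside e s \<longleftrightarrow> (\<forall>\<^sub>F \<epsilon> in at_right 0.
     fst e + of_real s * edge_dir e + of_real \<epsilon> * \<i> * edge_dir e \<in> inside (cycle_trace Q))"

text \<open>Around an inner point of a side the two sectors are half-disks, and the points tested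
  for nearby parameters all fall into the left one.\<close>

lemma left_inside_locally_constant:
  assumes e: "e \<in> set Q" and s: "0 < s" "s < 1"
  shows "\<exists>\<delta>>0. \<forall>s'. \<bar>s' - s\<bar> < \<delta> \<longrightarrow> left_inside e s' = left_inside e s"
proof -
  define d where "d = edge_dir e"
  have d: "d \<noteq> 0" using loopless[OF e] by (simp add: d_def edge_dir_def)
  define p where "p = fst e + of_real s * d"
  \<comment> \<open>The vectors from \<open>p\<close> to the two ends of the side. They are
    opposite, so \<open>sector a b\<close> is the left half-plane.\<close>
  define a where "a = of_real (1 - s) * d"
  define b where "b = of_real (- s) * d"
  have pa: "p + a = snd e" and pb: "p + b = fst e"
    by (simp_all add: p_def a_def b_def d_def edge_dir_def algebra_simps)
  have nz: "a \<noteq> 0" "b \<noteq> 0" using d s by (auto simp: a_def b_def)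
  have "cross a z = (1 - s) * cross d z" "cross z b = s * cross d z" for z
    unfolding a_def b_def cross_simps using cross_swap[of d z] by (simp_all add: algebra_simps)
  then have sec: "z \<in> sector a b" if "cross d z > 0" for z
    using that s by (simp add: mem_sector_iff)
  have pe: "p \<in> edge_seg e" "p \<noteq> fst e" "p \<noteq> snd e"
  proof -
    have "p = (1 - s) *\<^sub>R fst e + s *\<^sub>R snd e"
      by (simp add: p_def d_def edge_dir_def scaleR_conv_of_real algebra_simps)
    then show "p \<in> edge_seg e" unfolding edge_seg_def in_segment using s
      by (intro exI[of _ s] conjI) linarith+
    show "p \<noteq> fst e" "p \<noteq> snd e" using nz pa pb by (metis add_cancel_left_right)+
  qed
  have "closed_segment (fst e) (snd e) = closed_segment p (p + a) \<union> closed_segment p (p + b)"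
    using Un_closed_segment[of p "fst e" "snd e"] pe(1) unfolding pa pb edge_seg_def
    by (metis Un_commute closed_segment_commute)
  moreover have "f = e" if "f \<in> set Q" "p \<in> edge_seg f" for f
    using sides_meet[of e f] that e pe by blast
  ultimately have segs: "(\<exists>f\<in>set Q. p \<in> edge_seg f \<and> x \<in> edge_seg f) \<longleftrightarrow>
      x \<in> closed_segment p (p + a) \<union> closed_segment p (p + b)" for x
    using e pe(1) by (metis edge_seg_def)
  have "cross d (\<i> * d) > 0" using d by (simp add: cross_i)
  have "\<not> same_ray a b"
  proof
    assume "same_ray a b"
    then obtain k where k: "k > 0" "b = of_real k * a" unfolding same_ray_def by blast
    then have "of_real (k * (1 - s) + s) * d = 0" unfolding a_def b_def by (simp add: algebra_simps)
    then have "k * (1 - s) + s = 0" using d by (metis mult_eq_0_iff of_real_eq_0_iff)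
    then show False using k(1) s by (smt (verit) mult_pos_pos)
  qed
  then obtain r L where r: "r > 0"
      "\<And>z. z \<in> sector a b \<Longrightarrow> norm z < r \<Longrightarrow> p + z \<in> inside (cycle_trace Q) \<longleftrightarrow> L"
    using two_rays_sides[OF nz _ segs] by metis
  \<comment> \<open>Keeps the shift along the side and the shift to its left below r/2 each.\<close>
  define \<delta> where "\<delta> = r / (2 * norm d)"
  have \<delta>: "\<delta> > 0" "\<delta> * norm d = r / 2" using r(1) d by (simp_all add: \<delta>_def)
  have L: "left_inside e s' = L" if "\<bar>s' - s\<bar> < \<delta>" for s'
  proof -
    have "(fst e + of_real s' * d + of_real \<epsilon> * \<i> * d \<in> inside (cycle_trace Q)) = L"
      if \<epsilon>: "0 < \<epsilon> \<and> \<epsilon> < \<delta>" for \<epsilon>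
    proof -
      define z where "z = of_real (s' - s) * d + of_real \<epsilon> * (\<i> * d)"
      have "norm z \<le> \<bar>s' - s\<bar> * norm d + \<epsilon> * norm d"
        unfolding z_def using norm_triangle_ineq[of "of_real (s' - s) * d" "of_real \<epsilon> * (\<i> * d)"] \<epsilon>
        by (simp only: norm_mult norm_of_real norm_ii) simp
      also have "\<dots> < r" using \<open>\<bar>s' - s\<bar> < \<delta>\<close> \<epsilon> \<delta>(2) d
        by (smt (verit) field_sum_of_halves mult_strict_right_mono zero_less_norm_iff)
      finally have "norm z < r" .
      moreover have "cross d z > 0" unfolding z_def cross_simps using \<open>cross d (\<i> * d) > 0\<close> \<epsilon> by simp
      moreover have "fst e + of_real s' * d + of_real \<epsilon> * \<i> * d = p + z"
        by (simp add: p_def z_def algebra_simps)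
      ultimately show ?thesis using r(2) sec by simp
    qed
    then have "\<forall>\<^sub>F \<epsilon> in at_right 0.
        (fst e + of_real s' * d + of_real \<epsilon> * \<i> * d \<in> inside (cycle_trace Q)) = L"
      using eventually_small[OF \<delta>(1)] by (rule eventually_mono[rotated]) blast
    then have "left_inside e s' \<longleftrightarrow> (\<forall>\<^sub>F \<epsilon> in at_right (0::real). L)"
      unfolding left_inside_def d_def[symmetric] by (rule eventually_cong)
    then show ?thesis by simp
  qed
  then show ?thesis using \<delta>(1) L[of s] by auto
qed

text \<open>A locally constant predicate is constant on the connected open unit interval.\<close>

lemma left_inside_constant:
  assumes "e \<in> set Q" "0 < s" "s < 1" "0 < t" "t < 1"
  shows "left_inside e s = left_inside e t"
proof (rule connected_equivalence_relation[where S = "{0<..<1::real}"])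
  fix s :: real assume "s \<in> {0<..<1}"
  then obtain \<delta> where "\<delta> > 0" "\<forall>s'. \<bar>s' - s\<bar> < \<delta> \<longrightarrow> left_inside e s' = left_inside e s"
    using left_inside_locally_constant[OF assms(1), of s] by auto
  then show "\<exists>T. openin (top_of_set {0<..<1}) T \<and> s \<in> T \<and> (\<forall>x\<in>T. left_inside e s = left_inside e x)"
  proof (intro exI conjI ballI)
    show "openin (top_of_set {0<..<1}) ({0<..<1} \<inter> ball s \<delta>)" by (rule openin_open_Int[OF open_ball])
    show "s \<in> {0<..<1} \<inter> ball s \<delta>" using \<open>s \<in> {0<..<1}\<close> \<open>\<delta> > 0\<close> by simp
    show "left_inside e s = left_inside e x" if "x \<in> {0<..<1} \<inter> ball s \<delta>" for x
    proof -
      have "\<bar>x - s\<bar> < \<delta>" using that by (simp add: dist_real_def abs_minus_commute)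
      then show ?thesis using \<open>\<forall>s'. \<bar>s' - s\<bar> < \<delta> \<longrightarrow> left_inside e s' = left_inside e s\<close> by blast
    qed
  qed
qed (use assms in auto)

text \<open>Replaces the iterated limit at the ending point by the test at one arbitrary inner
  parameter.\<close>

lemma gamma1_iff_left_inside:
  assumes "e \<in> set Q" "0 < s" "s < 1"
  shows "gamma1 Q e = (if left_inside e s then 1 else 0)"
proof -
  have "\<forall>\<^sub>F t in at_right 0. left_inside e (1 - t) = left_inside e s"
  proof (rule eventually_mono[OF eventually_small[of 1]])
    show "left_inside e (1 - t) = left_inside e s" if "0 < t \<and> t < 1" for t
      using that assms by (intro left_inside_constant) simp_all
  qed simp
  then have "(\<forall>\<^sub>F t in at_right 0. left_inside e (1 - t)) \<longleftrightarrow> (\<forall>\<^sub>F t in at_right (0::real). left_inside e s)"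
    by (rule eventually_cong)
  moreover have "snd e - of_real t * edge_dir e = fst e + of_real (1 - t) * edge_dir e" for t
    by (simp add: edge_dir_def algebra_simps)
  ultimately show ?thesis unfolding gamma1_def left_inside_def by simp
qed

text \<open>A side through the common vertex has it as an endpoint, so it is \<open>q1\<close> or
  \<open>q2\<close> because starts and ends are unique. If both left the vertex along the same ray,
  they would share more than endpoints.\<close>

lemma
  assumes q1: "q1 \<in> set Q" and q2: "q2 \<in> set Q" and v: "snd q1 = fst q2"
  shows consecutive_not_same_ray: "\<not> same_ray (edge_dir q2) (- edge_dir q1)"
    and consecutive_segments: "(\<exists>e\<in>set Q. fst q2 \<in> edge_seg e \<and> x \<in> edge_seg e) \<longleftrightarrow>
      x \<in> closed_segment (fst q2) (fst q2 + edge_dir q2) \<union> closed_segment (fst q2) (fst q2 - edge_dir q1)"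
proof -
  have segs: "closed_segment (fst q2) (fst q2 + edge_dir q2) = edge_seg q2"
    "closed_segment (fst q2) (fst q2 - edge_dir q1) = edge_seg q1"
    using v by (simp_all add: edge_dir_def edge_seg_def closed_segment_commute)
  have "e = q1 \<or> e = q2" if "e \<in> set Q" "fst q2 \<in> edge_seg e" for e
  proof (rule ccontr)
    assume "\<not> ?thesis"
    then have ne: "e \<noteq> q1" "e \<noteq> q2" by auto
    moreover have "fst q2 \<in> edge_seg q2" by (simp add: edge_seg_def)
    ultimately have "fst q2 \<in> {fst e, snd e}" using sides_meet[of e q2] that q2 by blast
    then show False using start_inj[OF that(1) q2] end_inj[OF that(1) q1] ne v by auto
  qed
  moreover have "fst q2 \<in> edge_seg q1" "fst q2 \<in> edge_seg q2" using v by (simp_all add: edge_seg_def)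
  ultimately show "(\<exists>e\<in>set Q. fst q2 \<in> edge_seg e \<and> x \<in> edge_seg e) \<longleftrightarrow>
      x \<in> closed_segment (fst q2) (fst q2 + edge_dir q2) \<union> closed_segment (fst q2) (fst q2 - edge_dir q1)"
    unfolding segs using q1 q2 by blast
  have "q1 \<noteq> q2" using loopless[OF q1] v by auto
  then have "edge_seg q2 \<inter> edge_seg q1 \<subseteq> {fst q2, snd q2}" using sides_meet[OF q2 q1] by auto
  then have "closed_segment (fst q2) (fst q2 + edge_dir q2) \<inter>
      closed_segment (fst q2) (fst q2 + - edge_dir q1) \<subseteq> {fst q2, fst q2 + edge_dir q2}"
    using segs by (simp add: edge_dir_def[of q2])
  moreover have "edge_dir q2 \<noteq> 0" using loopless[OF q2] by (simp add: edge_dir_def)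
  ultimately show "\<not> same_ray (edge_dir q2) (- edge_dir q1)" by (rule segments_same_ray)
qed

text \<open>Just left of the end of \<open>q1\<close> and just left of the beginning of
  \<open>q2\<close> lie points of the same sector, the one counterclockwise from
  \<open>edge_dir q2\<close> to \<open>- edge_dir q1\<close>. So the region on the left does not
  change at a vertex.\<close>

lemma left_inside_at_vertex:
  assumes q1: "q1 \<in> set Q" and q2: "q2 \<in> set Q" and v: "snd q1 = fst q2" and s: "0 < s" "s < 1"
  obtains r where "r > 0" "left_inside q1 s = left_inside q2 s"
    "\<And>z. z \<in> sector (edge_dir q2) (- edge_dir q1) \<Longrightarrow> norm z < r \<Longrightarrow>
      fst q2 + z \<in> inside (cycle_trace Q) \<longleftrightarrow> left_inside q2 s"
    "\<And>z. z \<in> sector (- edge_dir q1) (edge_dir q2) \<Longrightarrow> norm z < r \<Longrightarrow>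
      fst q2 + z \<in> inside (cycle_trace Q) \<longleftrightarrow> \<not> left_inside q2 s"
proof -
  define a where "a = edge_dir q2"
  define b where "b = - edge_dir q1"
  have nz: "a \<noteq> 0" "b \<noteq> 0"
    using loopless[OF q1] loopless[OF q2] by (simp_all add: a_def b_def edge_dir_def)
  obtain r L where r: "r > 0"
    "\<And>z. z \<in> sector a b \<Longrightarrow> norm z < r \<Longrightarrow> fst q2 + z \<in> inside (cycle_trace Q) \<longleftrightarrow> L"
    "\<And>z. z \<in> sector b a \<Longrightarrow> norm z < r \<Longrightarrow> fst q2 + z \<in> inside (cycle_trace Q) \<longleftrightarrow> \<not> L"
    using two_rays_sides[OF nz, of "fst q2"] consecutive_not_same_ray[OF q1 q2 v]
      consecutive_segments[OF q1 q2 v] unfolding a_def b_def diff_conv_add_uminus by blast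
  \<comment> \<open>One parameter distance for both sides: \<open>m\<close> on \<open>q2\<close> and
    \<open>1 - m\<close> on \<open>q1\<close> are inner parameters, and the points tested there with
    \<epsilon> < m stay within distance \<open>r\<close> of the vertex.\<close>
  define m where "m = min (1/2) (r / (2 * (norm a + norm b)))"
  have nab: "norm a + norm b > 0" using nz by (simp add: add_pos_nonneg)
  have m: "0 < m" "m < 1" "m * (norm a + norm b) \<le> r / 2"
  proof -
    show "0 < m" using r(1) nab unfolding m_def by simp
    show "m < 1" unfolding m_def by simp
    have "m \<le> r / (2 * (norm a + norm b))" unfolding m_def by simp
    then show "m * (norm a + norm b) \<le> r / 2" using nab by (simp add: field_simps)
  qed
  have small: "norm (of_real m * c + of_real \<epsilon> * (\<i> * c')) < r"
    if "norm c \<le> norm a + norm b" "norm c' \<le> norm a + norm b" "0 < \<epsilon>" "\<epsilon> < m" for c c' :: complex and \<epsilon>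
  proof -
    have "norm (of_real m * c + of_real \<epsilon> * (\<i> * c')) \<le> m * norm c + \<epsilon> * norm c'"
      using norm_triangle_ineq[of "of_real m * c" "of_real \<epsilon> * (\<i> * c')"] m that
      by (simp only: norm_mult norm_of_real norm_ii)
    also have "\<dots> \<le> m * (norm a + norm b) + \<epsilon> * (norm a + norm b)"
      using m that by (intro add_mono mult_left_mono) auto
    also have "\<dots> < m * (norm a + norm b) + m * (norm a + norm b)"
      using that nab by simp
    also have "\<dots> \<le> r" using m(3) by simp
    finally show ?thesis .
  qed
  have pos: "cross a (\<i> * a) > 0" "cross b (\<i> * b) > 0"
    using nz by (simp_all add: cross_i)
  have "left_inside q2 m = L"
  proof -
    \<comment> \<open>The shift to the left yields one of the two sector inequalities outright. The
      other one is required only for a convex sector, where its leading term m *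
      \<open>cross a b\<close> is positive and dominates for small \<epsilon>.\<close>
    have "\<forall>\<^sub>F \<epsilon> in at_right 0. (0 < \<epsilon> \<and> \<epsilon> < m) \<and> (cross a b > 0 \<longrightarrow> m * cross a b + \<epsilon> * cross (\<i> * a) b > 0)"
      using eventually_small[OF m(1)] eventually_pos[of "m * cross a b" "cross (\<i> * a) b"] m(1)
      by (cases "cross a b > 0") (simp_all add: eventually_conj_iff)
    then have "\<forall>\<^sub>F \<epsilon> in at_right 0.
        (fst q2 + of_real m * a + of_real \<epsilon> * \<i> * a \<in> inside (cycle_trace Q)) = L"
    proof (rule eventually_mono)
      fix \<epsilon> assume e: "(0 < \<epsilon> \<and> \<epsilon> < m) \<and> (cross a b > 0 \<longrightarrow> m * cross a b + \<epsilon> * cross (\<i> * a) b > 0)"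
      define z where "z = of_real m * a + of_real \<epsilon> * (\<i> * a)"
      have "cross a z > 0" unfolding z_def cross_simps using pos e by simp
      moreover have "cross z b = m * cross a b + \<epsilon> * cross (\<i> * a) b" unfolding z_def cross_simps ..
      ultimately have "z \<in> sector a b" using e by (simp add: mem_sector_iff)
      moreover have "norm z < r" unfolding z_def using e by (intro small) auto
      moreover have "fst q2 + of_real m * a + of_real \<epsilon> * \<i> * a = fst q2 + z" by (simp add: z_def)
      ultimately show "(fst q2 + of_real m * a + of_real \<epsilon> * \<i> * a \<in> inside (cycle_trace Q)) = L"
        using r(2) by metis
    qed
    then have "left_inside q2 m \<longleftrightarrow> (\<forall>\<^sub>F \<epsilon> in at_right (0::real). L)"
      unfolding left_inside_def a_def[symmetric] by (rule eventually_cong)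
    then show ?thesis by simp
  qed
  moreover have "left_inside q1 (1 - m) = L"
  proof -
    have "\<forall>\<^sub>F \<epsilon> in at_right 0. (0 < \<epsilon> \<and> \<epsilon> < m) \<and> (cross a b > 0 \<longrightarrow> m * cross a b + \<epsilon> * - cross a (\<i> * b) > 0)"
      using eventually_small[OF m(1)] eventually_pos[of "m * cross a b" "- cross a (\<i> * b)"] m(1)
      by (cases "cross a b > 0") (simp_all add: eventually_conj_iff)
    then have "\<forall>\<^sub>F \<epsilon> in at_right 0.
        (fst q1 + of_real (1 - m) * edge_dir q1 + of_real \<epsilon> * \<i> * edge_dir q1 \<in> inside (cycle_trace Q)) = L"
    proof (rule eventually_mono)
      fix \<epsilon> assume e: "(0 < \<epsilon> \<and> \<epsilon> < m) \<and> (cross a b > 0 \<longrightarrow> m * cross a b + \<epsilon> * - cross a (\<i> * b) > 0)"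
      \<comment> \<open>Seen from the vertex, \<open>q1\<close> runs in direction \<open>b\<close>,
        opposite to its orientation. Its left is therefore the right of \<open>b\<close>.\<close>
      define z where "z = of_real m * b + of_real \<epsilon> * (\<i> * (- b))"
      have z: "z = of_real m * b - of_real \<epsilon> * (\<i> * b)" by (simp add: z_def)
      have "cross z b = - cross b z" by (rule cross_swap)
      also have "\<dots> > 0" unfolding z diff_conv_add_uminus cross_simps using pos e by simp
      finally have "cross z b > 0" .
      moreover have "cross a z = m * cross a b + \<epsilon> * - cross a (\<i> * b)"
        unfolding z diff_conv_add_uminus cross_simps by simp
      ultimately have "z \<in> sector a b" using e by (simp add: mem_sector_iff)
      moreover have "norm z < r" unfolding z_def using e by (intro small) auto
      moreover have "fst q1 + of_real (1 - m) * edge_dir q1 + of_real \<epsilon> * \<i> * edge_dir q1 = fst q2 + z"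
        unfolding z b_def v[symmetric] by (simp add: edge_dir_def algebra_simps)
      ultimately show "(fst q1 + of_real (1 - m) * edge_dir q1 + of_real \<epsilon> * \<i> * edge_dir q1
          \<in> inside (cycle_trace Q)) = L"
        using r(2) by metis
    qed
    then have "left_inside q1 (1 - m) \<longleftrightarrow> (\<forall>\<^sub>F \<epsilon> in at_right (0::real). L)"
      unfolding left_inside_def by (rule eventually_cong)
    then show ?thesis by simp
  qed
  ultimately have "left_inside q1 s = L" "left_inside q2 s = L"
    using left_inside_constant[OF q1 s, of "1 - m"] left_inside_constant[OF q2 s, of m] m by auto
  then show ?thesis using that r unfolding a_def b_def by blast
qed

lemma gamma1_consecutive:
  assumes "q1 \<in> set Q" "q2 \<in> set Q" "snd q1 = fst q2"
  shows "gamma1 Q q1 = gamma1 Q q2"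
  using left_inside_at_vertex[OF assms, of "1/2"] gamma1_iff_left_inside[OF assms(1), of "1/2"]
    gamma1_iff_left_inside[OF assms(2), of "1/2"] by auto

text \<open>The direction \<open>c\<close> lies in one of the two sectors, and with it every
  positive multiple. The left sector is the inner one exactly if \<open>gamma1\<close> is 1.\<close>

lemma third_direction_inside_iff:
  assumes q: "q1 \<in> set Q" "q2 \<in> set Q" "snd q1 = fst q2"
    and c: "c \<noteq> 0" "\<not> same_ray (edge_dir q2) c" "\<not> same_ray (- edge_dir q1) c"
  shows "\<forall>\<^sub>F t in at_right 0. (fst q2 + of_real t * c \<in> inside (cycle_trace Q)) =
    (c \<in> sector (edge_dir q2) (- edge_dir q1) \<longleftrightarrow> gamma1 Q q1 = 1)"
proof -
  obtain r where r: "r > 0" "left_inside q1 (1/2) = left_inside q2 (1/2)"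
    "\<And>z. z \<in> sector (edge_dir q2) (- edge_dir q1) \<Longrightarrow> norm z < r \<Longrightarrow>
      fst q2 + z \<in> inside (cycle_trace Q) \<longleftrightarrow> left_inside q2 (1/2)"
    "\<And>z. z \<in> sector (- edge_dir q1) (edge_dir q2) \<Longrightarrow> norm z < r \<Longrightarrow>
      fst q2 + z \<in> inside (cycle_trace Q) \<longleftrightarrow> \<not> left_inside q2 (1/2)"
    using left_inside_at_vertex[OF q, of "1/2"] by auto
  have g: "left_inside q2 (1/2) \<longleftrightarrow> gamma1 Q q1 = 1"
    using gamma1_iff_left_inside[OF q(1), of "1/2"] r(2) by simp
  have nz: "edge_dir q2 \<noteq> 0" "- edge_dir q1 \<noteq> 0"
    using loopless[OF q(1)] loopless[OF q(2)] by (simp_all add: edge_dir_def)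
  have cov: "c \<in> sector (edge_dir q2) (- edge_dir q1) \<union> sector (- edge_dir q1) (edge_dir q2)"
    using sectors_cover[OF nz consecutive_not_same_ray[OF q] c] .
  have "r / norm c > 0" using r(1) c(1) by simp
  from eventually_small[OF this] show ?thesis
  proof (rule eventually_mono)
    fix t assume t: "0 < t \<and> t < r / norm c"
    then have "norm (of_real t * c) < r" using c(1) by (simp add: norm_mult pos_less_divide_eq)
    then show "(fst q2 + of_real t * c \<in> inside (cycle_trace Q)) =
      (c \<in> sector (edge_dir q2) (- edge_dir q1) \<longleftrightarrow> gamma1 Q q1 = 1)"
      using r(3,4)[of "of_real t * c"] sector_scale[of t c] t cov g by auto
  qed
qed

end

section \<open>The cycle in the network\<close>

text \<open>Two equations are equivalent if their residuals are proportional with a nonzero factor.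
  All comparisons of edge equations below take this form.\<close>

lemma scaleR_diff_imp_eq_iff:
  fixes x :: "'v :: real_vector"
  assumes "x' - y' = c *\<^sub>R (x - y)" "c \<noteq> 0"
  shows "x = y \<longleftrightarrow> x' = y'"
  using assms by (metis eq_iff_diff_eq_0 scaleR_eq_0_iff)

definition sign :: "int \<Rightarrow> real" where
  "sign k = (if even k then 1 else -1)"

lemma sign_powi: "(-1) powi k = sign k"
  by (simp add: sign_def power_int_minus_left)

lemma sign_power: "(-1) ^ n = sign (int n)"
  by (simp add: sign_def)

lemma sign_add: "sign (j + k) = sign j * sign k"
  by (simp add: sign_def)

lemma sign_square [simp]: "sign k * sign k = 1"
  by (simp add: sign_def)

lemma sign_nonzero [simp]: "sign k \<noteq> 0"
  by (simp add: sign_def)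

lemma sign_eqI: "even (j + k) \<Longrightarrow> sign j = sign k"
  by (auto simp: sign_def)

lemma sign_eq_minusI: "odd (j + k) \<Longrightarrow> sign j = - sign k"
  by (auto simp: sign_def)

text \<open>Leaving \<open>x\<close> open gives the equations at internal vertices, with
  \<open>edge_combination\<close>, and those at sinks, with the boundary vector, a common
  form.\<close>

definition edge_equation ::
  "'n plabic_data \<Rightarrow> complex \<Rightarrow> (complex \<times> complex \<Rightarrow> 'v) \<Rightarrow> complex \<times> complex \<Rightarrow> 'v :: real_vector \<Rightarrow> bool"
  where "edge_equation N l E e x \<longleftrightarrow> E e = (sign (int (int_num N l e)) * weight N e) *\<^sub>R x"

definition edge_combination ::
  "'n plabic_data \<Rightarrow> complex \<Rightarrow> (complex \<times> complex \<Rightarrow> 'v :: real_vector) \<Rightarrow> complex \<times> complex \<Rightarrow> 'v"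
  where "edge_combination N l E e =
    (\<Sum>f | f \<in> parcs (graph N) \<and> fst f = snd e. sign (wind l e f) *\<^sub>R E f)"

lemma solves_edge_equations_iff:
  "solves_edge_equations N l B E \<longleftrightarrow>
    (\<forall>v \<in> internal N. \<forall>e \<in> {e \<in> parcs (graph N). snd e = v}. edge_equation N l E e (edge_combination N l E e)) \<and>
    (\<forall>j. j \<notin> pivots N \<longrightarrow> (\<forall>e \<in> {e \<in> parcs (graph N). snd e = bvert N j}. edge_equation N l E e (B j)))"
  unfolding solves_edge_equations_def edge_equation_def edge_combination_def sign_powi sign_power out_arcs_def
  by auto

lemma edge_dir_swap: "edge_dir (prod.swap e) = - edge_dir e"
  by (simp add: edge_dir_def)

lemma wind_eq_turn: "wind l e f = turn l (edge_dir e) (edge_dir f)"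
  by (simp add: wind_def turn_def)

section \<open>The cycle, the disk and its boundary vertices\<close>

locale network_cycle = plabic_network N
  for N :: "'n :: {finite, linorder} plabic_data" +
  fixes l :: complex and Q :: "(complex \<times> complex) list" and u :: complex
  assumes gauge: "gauge_direction N l"
    and walk: "pcas u Q u" "Q \<noteq> []" "set Q \<subseteq> parcs (graph N)" "distinct (map snd Q)"
begin

lemma polygon: "simple_polygon Q u"
proof
  show "fst e \<noteq> snd e" if "e \<in> set Q" for e using that walk(3) pair_no_loops by blast
  show "edge_seg e \<inter> edge_seg f \<subseteq> {fst e, snd e} \<inter> {fst f, snd f}"
    if "e \<in> set Q" "f \<in> set Q" "e \<noteq> f" for e f
    using that walk(3) by (intro edges_meet) auto
qed (use walk in auto)

sublocale poly: simple_polygon Q u by (rule polygon)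

abbreviation trace :: "complex set" where "trace \<equiv> cycle_trace Q"

lemma finite_arcs_at: "finite {e \<in> parcs (graph N). P e}"
  using pair_finite_arcs by simp

lemma arcs_not_parallel_gauge: "e \<in> parcs (graph N) \<Longrightarrow> orient l (edge_dir e) \<noteq> 0"
  using gauge unfolding gauge_direction_def by blast

lemma side_not_parallel_gauge: "q \<in> set Q \<Longrightarrow> orient l (edge_dir q) \<noteq> 0"
  using arcs_not_parallel_gauge walk(3) by blast

lemma edge_dir_nonzero: "e \<in> parcs (graph N) \<Longrightarrow> edge_dir e \<noteq> 0"
  using pair_no_loops unfolding edge_dir_def by (metis right_minus_eq)

lemma cycle_vertex:
  assumes "v \<in> snd ` set Q"
  obtains q1 q2 where "q1 \<in> set Q" "q2 \<in> set Q" "snd q1 = v" "fst q2 = v"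
  using assms poly.fst_set by (metis imageE)

text \<open>A vertex of the cycle has an incoming and an outgoing edge, whereas a boundary vertex
  has total degree 1.\<close>

lemma cycle_vertex_internal:
  assumes "v \<in> snd ` set Q"
  shows "v \<in> internal N"
proof -
  obtain q1 q2 where q: "q1 \<in> set Q" "q2 \<in> set Q" "snd q1 = v" "fst q2 = v"
    using cycle_vertex assms .
  have "v \<noteq> bvert N j" for j
  proof
    assume "v = bvert N j"
    then have "q1 \<in> in_arcs (graph N) (bvert N j)" "q2 \<in> out_arcs (graph N) (bvert N j)"
      using q walk(3) by (auto simp: in_arcs_def out_arcs_def)
    moreover have "finite (in_arcs (graph N) (bvert N j))" "finite (out_arcs (graph N) (bvert N j))"
      by (auto simp: in_arcs_def out_arcs_def finite_arcs_at)
    ultimately have "in_degree (graph N) (bvert N j) > 0" "out_degree (graph N) (bvert N j) > 0"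
      unfolding in_degree_def out_degree_def by (auto simp: card_gt_0_iff)
    then show False using degree_boundary[of j] by simp
  qed
  moreover have "v \<in> pverts (graph N)" using q walk(3) arc_snd_in_verts by blast
  ultimately show ?thesis unfolding internal_def by auto
qed

lemma side_vertices: "q \<in> set Q \<Longrightarrow> fst q \<in> snd ` set Q \<and> snd q \<in> snd ` set Q"
  using poly.fst_set by blast

lemma vertex_in_trace_iff:
  assumes "v \<in> pverts (graph N)"
  shows "v \<in> trace \<longleftrightarrow> v \<in> snd ` set Q"
proof
  assume "v \<in> trace"
  then obtain q where q: "q \<in> set Q" "v \<in> edge_seg q" unfolding cycle_trace_def by blast
  then have "v = fst q \<or> v = snd q" using vertex_on_edge assms walk(3) by blast
  then show "v \<in> snd ` set Q" using side_vertices q by blast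
next
  assume "v \<in> snd ` set Q"
  then show "v \<in> trace" unfolding cycle_trace_def edge_seg_def by fastforce
qed

lemma trace_in_disk: "trace \<subseteq> interior (disk N)"
proof -
  have "edge_seg q \<subseteq> interior (disk N)" if "q \<in> set Q" for q
    unfolding edge_seg_def using side_vertices[OF that] cycle_vertex_internal internal_inside
      convex_interior[OF disk(2)] by (intro closed_segment_subset) auto
  then show ?thesis unfolding cycle_trace_def by blast
qed

text \<open>The cycle lies in the convex interior of the disk, so everything outside that interior,
  including the frontier with the boundary vertices, is in the outer region.\<close>

lemma boundary_vertex_not_inside: "bvert N j \<notin> inside trace" "bvert N j \<notin> trace"
proof -
  have "bvert N j \<notin> interior (disk N)"
    using segment unfolding frontier_def by blast
  moreover have "- interior (disk N) \<subseteq> outside trace"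
    using outside_subset_convex[OF convex_interior[OF disk(2)] trace_in_disk] .
  ultimately show "bvert N j \<notin> inside trace" "bvert N j \<notin> trace"
    using trace_in_disk inside_Int_outside[of trace] by blast+
qed

text \<open>An edge and its reverse would overlap in a whole segment, while distinct edges share
  endpoints at most. Hence the reversed sides are new edges and the case distinction in the new
  weights is unambiguous.\<close>

lemma reverse_not_arc:
  assumes "e \<in> parcs (graph N)" shows "prod.swap e \<notin> parcs (graph N)"
proof
  assume "prod.swap e \<in> parcs (graph N)"
  moreover have "prod.swap e \<noteq> e" using pair_no_loops[OF assms] by (cases e) auto
  ultimately have "edge_seg e \<inter> edge_seg (prod.swap e) \<subseteq> {fst e, snd e}"
    using edges_meet[OF assms, of "prod.swap e"] by auto
  moreover have "edge_seg (prod.swap e) = edge_seg e"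
    by (simp add: edge_seg_def closed_segment_commute)
  ultimately have "closed_segment (fst e) (snd e) \<subseteq> {fst e, snd e}"
    by (metis Int_absorb edge_seg_def)
  then have "finite (closed_segment (fst e) (snd e))" by (rule finite_subset) simp
  then show False using pair_no_loops[OF assms] by (simp add: finite_closed_segment)
qed

section \<open>The index of edges off the cycle\<close>

lemma open_edge_off_trace:
  assumes "g \<in> parcs (graph N)" "g \<notin> set Q"
  shows "open_segment (fst g) (snd g) \<inter> trace = {}"
proof -
  have "edge_seg g \<inter> edge_seg q \<subseteq> {fst g, snd g}" if "q \<in> set Q" for q
    using edges_meet[OF assms(1), of q] that assms(2) walk(3) by auto
  then show ?thesis unfolding cycle_trace_def edge_seg_def open_segment_def by blast
qed

text \<open>Attaches the region to the whole edge instead of its starting vertex, so that it can be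
  read off at either end.\<close>

definition edge_inside :: "complex \<times> complex \<Rightarrow> bool" where
  "edge_inside g \<longleftrightarrow> open_segment (fst g) (snd g) \<subseteq> inside trace"

lemma connected_edge_inside_iff:
  assumes "g \<in> parcs (graph N)" "g \<notin> set Q" "x \<in> open_segment (fst g) (snd g)"
  shows "x \<in> inside trace \<longleftrightarrow> edge_inside g"
  using connected_inside_or_not[OF poly.trace_closed convex_connected[OF convex_open_segment]
      open_edge_off_trace[OF assms(1,2)]] assms(3) unfolding edge_inside_def by blast

lemma near_end_inside_iff:
  assumes "g \<in> parcs (graph N)" "g \<notin> set Q"
    and "v = fst g \<and> c = edge_dir g \<or> v = snd g \<and> c = - edge_dir g"
  shows "\<forall>\<^sub>F t in at_right 0. (v + of_real t * c \<in> inside trace) = edge_inside g"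
proof (rule eventually_mono[OF eventually_small[of 1]])
  fix t :: real assume t: "0 < t \<and> t < 1"
  have "v + of_real t * c \<in> open_segment (fst g) (snd g)"
    using assms(3)
  proof
    assume "v = fst g \<and> c = edge_dir g"
    then have "v + of_real t * c = (1 - t) *\<^sub>R fst g + t *\<^sub>R snd g"
      by (simp add: edge_dir_def scaleR_conv_of_real) (simp add: algebra_simps)
    then show ?thesis unfolding in_segment(2) using t pair_no_loops[OF assms(1)] by blast
  next
    assume "v = snd g \<and> c = - edge_dir g"
    then have "v + of_real t * c = (1 - (1 - t)) *\<^sub>R fst g + (1 - t) *\<^sub>R snd g"
      by (simp add: edge_dir_def scaleR_conv_of_real) (simp add: algebra_simps)
    moreover have "0 < 1 - t" "1 - t < 1" using t by auto
    ultimately show ?thesis unfolding in_segment(2) using pair_no_loops[OF assms(1)] by blast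
  qed
  then show "(v + of_real t * c \<in> inside trace) = edge_inside g"
    using connected_edge_inside_iff[OF assms(1,2)] by blast
qed simp

text \<open>The open edge together with this endpoint is connected, being between the open edge and
  its closure, and it misses the cycle.\<close>

lemma end_off_trace_inside_iff:
  assumes "g \<in> parcs (graph N)" "g \<notin> set Q" "v = fst g \<or> v = snd g" "v \<notin> trace"
  shows "v \<in> inside trace \<longleftrightarrow> edge_inside g"
proof -
  let ?S = "open_segment (fst g) (snd g)"
  have ne: "fst g \<noteq> snd g" using pair_no_loops assms(1) by blast
  have "?S \<subseteq> closed_segment (fst g) (snd g)" using open_closed_segment by blast
  moreover have "v \<in> closed_segment (fst g) (snd g)" using assms(3) ends_in_segment by metis
  ultimately have "insert v ?S \<subseteq> closure ?S" using ne by (simp add: closure_open_segment)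
  then have "Topological_Spaces.connected (insert v ?S)"
    by (rule connected_intermediate_closure[OF convex_connected[OF convex_open_segment] subset_insertI])
  moreover have "insert v ?S \<inter> trace = {}" using open_edge_off_trace assms by blast
  ultimately have "insert v ?S \<subseteq> inside trace \<or> insert v ?S \<inter> inside trace = {}"
    using connected_inside_or_not[OF poly.trace_closed] by blast
  moreover have "?S \<noteq> {}" using ne by simp
  ultimately show ?thesis unfolding edge_inside_def by blast
qed

lemma gamma_off_cycle:
  assumes "g \<in> parcs (graph N)" "g \<notin> set Q"
  shows "gamma N l Q g = (if edge_inside g then 1 else 0)"
proof (cases "fst g \<in> trace")
  case True
  have "(\<forall>\<^sub>F t in at_right 0. fst g + of_real t * edge_dir g \<in> inside trace) \<longleftrightarrow>
      (\<forall>\<^sub>F t in at_right (0::real). edge_inside g)"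
    by (rule eventually_cong) (use near_end_inside_iff[OF assms] in blast)
  then show ?thesis using True assms(2) unfolding gamma_def by simp
next
  case False
  then show ?thesis using end_off_trace_inside_iff[OF assms, of "fst g"] assms(2) unfolding gamma_def by simp
qed

text \<open>The index refers to the starting vertex, but the region can be read at the sink, which
  is in the outer one. Boundary values thus keep their sign.\<close>

lemma gamma_to_sink:
  assumes "g \<in> parcs (graph N)" "snd g = bvert N j"
  shows "g \<notin> set Q" "gamma N l Q g = 0"
proof -
  show "g \<notin> set Q"
    using cycle_vertex_internal[of "snd g"] assms(2) unfolding internal_def
    by (metis DiffD2 imageI rangeI)
  then show "gamma N l Q g = 0"
    using end_off_trace_inside_iff[of g "snd g"] gamma_off_cycle assms boundary_vertex_not_inside by auto
qed

lemma gamma_off_trace: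
  assumes "e \<in> parcs (graph N)" "f \<in> parcs (graph N)" "snd e = fst f" "snd e \<notin> snd ` set Q"
  shows "e \<notin> set Q" "f \<notin> set Q" "gamma N l Q e = gamma N l Q f"
proof -
  show "e \<notin> set Q" "f \<notin> set Q" using assms(3,4) side_vertices by (metis imageI, metis)
  moreover have "snd e \<notin> trace" using assms vertex_in_trace_iff arc_snd_in_verts by blast
  ultimately show "gamma N l Q e = gamma N l Q f"
    using end_off_trace_inside_iff[of e "snd e"] end_off_trace_inside_iff[of f "snd e"]
      gamma_off_cycle assms by auto
qed

text \<open>\<open>c\<close> is the direction in which the edge \<open>g\<close> leaves the vertex \<open>v\<close>, irrespective of
  the orientation of \<open>g\<close>.\<close>

lemma edge_at_cycle_vertex:
  assumes q: "q1 \<in> set Q" "q2 \<in> set Q" "snd q1 = v" "fst q2 = v"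
    and g: "g \<in> parcs (graph N)" "g \<notin> set Q"
    and c: "v = fst g \<and> c = edge_dir g \<or> v = snd g \<and> c = - edge_dir g"
  shows "\<not> same_ray (edge_dir q2) c" "\<not> same_ray (- edge_dir q1) c"
    "edge_inside g \<longleftrightarrow> (c \<in> sector (edge_dir q2) (- edge_dir q1) \<longleftrightarrow> gamma1 Q q1 = 1)"
proof -
  have seg: "edge_seg g = closed_segment v (v + c)"
    "edge_seg q1 = closed_segment v (v + - edge_dir q1)"
    "edge_seg q2 = closed_segment v (v + edge_dir q2)"
    using c q(3,4) by (auto simp: edge_seg_def edge_dir_def closed_segment_commute)
  have ends: "{fst q1, snd q1} = {v, v + - edge_dir q1}" "{fst q2, snd q2} = {v, v + edge_dir q2}"
    using q(3,4) by (auto simp: edge_dir_def)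
  have "edge_seg q1 \<inter> edge_seg g \<subseteq> {fst q1, snd q1}" "edge_seg q2 \<inter> edge_seg g \<subseteq> {fst q2, snd q2}"
    using edges_meet[of q1 g] edges_meet[of q2 g] q g walk(3) by auto
  note meet = this[unfolded seg ends]
  have "edge_dir q1 \<noteq> 0" "edge_dir q2 \<noteq> 0" using edge_dir_nonzero q(1,2) walk(3) by blast+
  then show nr: "\<not> same_ray (- edge_dir q1) c" "\<not> same_ray (edge_dir q2) c"
    using segments_same_ray[OF meet(1)] segments_same_ray[OF meet(2)] by simp_all
  have "c \<noteq> 0" using c edge_dir_nonzero[OF g(1)] by auto
  from poly.third_direction_inside_iff[OF q(1,2) _ this nr(2,1)]
  have "\<forall>\<^sub>F t in at_right 0. (v + of_real t * c \<in> inside trace) =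
      (c \<in> sector (edge_dir q2) (- edge_dir q1) \<longleftrightarrow> gamma1 Q q1 = 1)"
    using q by simp
  moreover have "\<forall>\<^sub>F t in at_right 0. (v + of_real t * c \<in> inside trace) = edge_inside g"
    by (rule near_end_inside_iff[OF g c])
  ultimately have "\<forall>\<^sub>F t in at_right (0::real). edge_inside g =
      (c \<in> sector (edge_dir q2) (- edge_dir q1) \<longleftrightarrow> gamma1 Q q1 = 1)"
    by eventually_elim auto
  then show "edge_inside g \<longleftrightarrow> (c \<in> sector (edge_dir q2) (- edge_dir q1) \<longleftrightarrow> gamma1 Q q1 = 1)"
    by simp
qed

section \<open>Parity identities for the index at a vertex of the cycle\<close>

lemma gamma1_values: "gamma1 Q e = 0 \<or> gamma1 Q e = 1"
  by (simp add: gamma1_def)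

lemma gamma_on_cycle:
  "q \<in> set Q \<Longrightarrow> gamma N l Q q = gamma1 Q q + half_turn l (edge_dir q) + int (int_num N l q)"
  by (simp add: gamma_def gamma2_def half_turn_def)

text \<open>The two \<open>gamma1\<close> agree and each intersection number occurs twice. What is
  left is \<open>parity_through\<close>.\<close>

lemma gamma_cycle_parity:
  assumes q: "q1 \<in> set Q" "q2 \<in> set Q" "snd q1 = v" "fst q2 = v"
  shows "even (gamma N l Q q2 + int_num N l q2 + wind l (prod.swap q2) (prod.swap q1) +
    gamma N l Q q1 + int_num N l q1 + wind l q1 q2)"
proof -
  have "even (half_turn l (edge_dir q1) + half_turn l (edge_dir q2) +
      turn l (edge_dir q1) (edge_dir q2) + turn l (- edge_dir q2) (- edge_dir q1))"
    using q(3,4) by (intro parity_through side_not_parallel_gauge q(1,2)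
        poly.consecutive_not_same_ray) simp
  moreover have "gamma1 Q q1 = gamma1 Q q2" using poly.gamma1_consecutive q by metis
  ultimately show ?thesis
    unfolding gamma_on_cycle[OF q(1)] gamma_on_cycle[OF q(2)] wind_eq_turn edge_dir_swap even_add
    by simp satx
qed

text \<open>The sum of the index of \<open>e\<close> and \<open>gamma1 Q q1\<close> is odd exactly
  if \<open>e\<close> arrives from the right of the cycle. By \<open>parity_join\<close> the half
  turn and the windings are odd in the same case.\<close>

lemma gamma_incoming_parity:
  assumes q: "q1 \<in> set Q" "q2 \<in> set Q" "snd q1 = v" "fst q2 = v"
    and e: "e \<in> parcs (graph N)" "e \<notin> set Q" "snd e = v"
  shows "even (gamma N l Q e + wind l e q2 + wind l e (prod.swap q1) +
    gamma N l Q q1 + int_num N l q1 + wind l q1 q2)"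
proof -
  have c: "v = fst e \<and> - edge_dir e = edge_dir e \<or> v = snd e \<and> - edge_dir e = - edge_dir e"
    using e by simp
  note at = edge_at_cycle_vertex[OF q e(1,2) c]
  have "odd (half_turn l (edge_dir q1) + turn l (edge_dir q1) (edge_dir q2) +
      turn l (edge_dir e) (edge_dir q2) + turn l (edge_dir e) (- edge_dir q1)) \<longleftrightarrow>
      - edge_dir e \<notin> sector (edge_dir q2) (- edge_dir q1)"
    using q(3,4) by (intro parity_join side_not_parallel_gauge q(1,2) at(1,2)
        arcs_not_parallel_gauge[OF e(1)] poly.consecutive_not_same_ray) simp
  then show ?thesis
    using at(3) gamma1_values[of q1]
    unfolding gamma_on_cycle[OF q(1)] gamma_off_cycle[OF e(1,2)] wind_eq_turn edge_dir_swap even_add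
    by (elim disjE; cases "edge_inside e"; simp) satx+
qed

text \<open>Here \<open>parity_split\<close> makes the half turn and the windings odd for an edge
  leaving to the left, while the index of \<open>g\<close> plus \<open>gamma1 Q q1\<close> is odd on
  the right. The total is therefore odd, in contrast to the incoming case.\<close>

lemma gamma_outgoing_parity:
  assumes q: "q1 \<in> set Q" "q2 \<in> set Q" "snd q1 = v" "fst q2 = v"
    and g: "g \<in> parcs (graph N)" "g \<notin> set Q" "fst g = v"
  shows "odd (wind l (prod.swap q2) (prod.swap q1) + gamma N l Q q1 + int_num N l q1 +
    wind l q1 g + wind l (prod.swap q2) g + gamma N l Q g)"
proof -
  have c: "v = fst g \<and> edge_dir g = edge_dir g \<or> v = snd g \<and> edge_dir g = - edge_dir g"
    using g by simp
  note at = edge_at_cycle_vertex[OF q g(1,2) c]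
  have "odd (half_turn l (edge_dir q1) + turn l (edge_dir q1) (edge_dir g) +
      turn l (- edge_dir q2) (edge_dir g) + turn l (- edge_dir q2) (- edge_dir q1)) \<longleftrightarrow>
      edge_dir g \<in> sector (edge_dir q2) (- edge_dir q1)"
    using q(3,4) by (intro parity_split side_not_parallel_gauge q(1,2) at(1,2)
        arcs_not_parallel_gauge[OF g(1)] poly.consecutive_not_same_ray) simp
  then show ?thesis
    using at(3) gamma1_values[of q1]
    unfolding gamma_on_cycle[OF q(1)] gamma_off_cycle[OF g(1,2)] wind_eq_turn edge_dir_swap even_add
    by (elim disjE; cases "edge_inside g"; simp) satx+
qed

section \<open>The edge equations\<close>

abbreviation (input) "\<iota> e \<equiv> sign (int (int_num N l e))"
abbreviation (input) "\<sigma> e \<equiv> sign (gamma N l Q e)"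
abbreviation (input) "\<omega> e f \<equiv> sign (wind l e f)"
abbreviation (input) "M \<equiv> reverse_along Q N"

lemma parcs_reverse: "parcs (graph M) = (parcs (graph N) - set Q) \<union> prod.swap ` set Q"
  by (simp add: reverse_along_def)

lemma bvert_reverse: "bvert M = bvert N" and internal_reverse: "internal M = internal N"
  by (simp_all add: reverse_along_def internal_def)

lemma boundary_not_side_end: "bvert N j \<notin> snd ` set Q"
  using cycle_vertex_internal unfolding internal_def by blast

lemma no_sides_at:
  assumes "v \<notin> snd ` set Q"
  shows "{q \<in> set Q. fst q = v} = {}" "{q \<in> set Q. snd q = v} = {}"
proof -
  have "fst q \<noteq> v" "snd q \<noteq> v" if "q \<in> set Q" for q
    using side_vertices[OF that] assms by auto
  then show "{q \<in> set Q. fst q = v} = {}" "{q \<in> set Q. snd q = v} = {}" by blast+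
qed

text \<open>The cycle avoids boundary vertices. So the sources, the gauge rays and all intersection
  numbers survive the reversal.\<close>

lemma pivots_reverse: "pivots M = pivots N"
proof -
  have "fst (prod.swap q) \<noteq> bvert N j" "fst q \<noteq> bvert N j" if "q \<in> set Q" for q j
    using side_vertices[OF that] boundary_not_side_end[of j] by (metis fst_swap, metis)
  then show ?thesis unfolding pivots_def parcs_reverse bvert_reverse by blast
qed

lemma int_num_reverse: "int_num M l e = int_num N l e"
  by (simp add: int_num_def pivots_reverse bvert_reverse)

lemma int_num_swap: "int_num N l (prod.swap e) = int_num N l e"
  by (simp add: int_num_def edge_seg_def closed_segment_commute)

lemma weight_reverse:
  "e \<in> parcs (graph N) \<Longrightarrow> weight M e = weight N e"
  "q \<in> set Q \<Longrightarrow> weight M (prod.swap q) = 1 / weight N q"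
  using reverse_not_arc[of "prod.swap e"] walk(3) by (auto simp: reverse_along_def)

lemma weight_nonzero: "q \<in> set Q \<Longrightarrow> weight N q \<noteq> 0"
  using weight_pos walk(3) by (metis order_less_irrefl subsetD)

lemma in_reverse: "{e \<in> parcs (graph M). snd e = v} =
    {e \<in> parcs (graph N). snd e = v \<and> e \<notin> set Q} \<union> prod.swap ` {q \<in> set Q. fst q = v}"
  unfolding parcs_reverse by force

lemma out_reverse: "{e \<in> parcs (graph M). fst e = v} =
    {e \<in> parcs (graph N). fst e = v \<and> e \<notin> set Q} \<union> prod.swap ` {q \<in> set Q. snd q = v}"
  unfolding parcs_reverse by force

section \<open>Equivalence of the equations vertex by vertex\<close>

context
  fixes E Ehat :: "complex \<times> complex \<Rightarrow> 'v :: real_vector"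
  assumes off: "\<And>e. e \<in> parcs (graph N) \<Longrightarrow> e \<notin> set Q \<Longrightarrow> Ehat e = \<sigma> e *\<^sub>R E e"
    and on: "\<And>e. e \<in> set Q \<Longrightarrow> Ehat (prod.swap e) = (\<sigma> e / weight N e) *\<^sub>R E e"
begin

lemma sink_equations:
  "(\<forall>e \<in> {e \<in> parcs (graph M). snd e = bvert N j}. edge_equation M l Ehat e x) \<longleftrightarrow>
   (\<forall>e \<in> {e \<in> parcs (graph N). snd e = bvert N j}. edge_equation N l E e x)"
proof -
  note no = no_sides_at(1)[OF boundary_not_side_end[of j]]
  have "{e \<in> parcs (graph M). snd e = bvert N j} = {e \<in> parcs (graph N). snd e = bvert N j}"
    unfolding in_reverse no using gamma_to_sink(1) by blast
  moreover have "edge_equation M l Ehat e x \<longleftrightarrow> edge_equation N l E e x"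
    if "e \<in> parcs (graph N)" "snd e = bvert N j" for e
    using off[OF that(1) gamma_to_sink(1)[OF that]] gamma_to_sink(2)[OF that] weight_reverse(1)[OF that(1)]
    by (simp add: edge_equation_def int_num_reverse sign_def)
  ultimately show ?thesis by blast
qed

text \<open>All edges at \<open>v\<close> carry the same index, so each residual is only multiplied
  by a common sign.\<close>

lemma equations_off_cycle:
  assumes v: "v \<notin> snd ` set Q"
  shows "(\<forall>e \<in> {e \<in> parcs (graph M). snd e = v}. edge_equation M l Ehat e (edge_combination M l Ehat e)) \<longleftrightarrow>
   (\<forall>e \<in> {e \<in> parcs (graph N). snd e = v}. edge_equation N l E e (edge_combination N l E e))"
proof -
  note no = no_sides_at[OF v]
  have ins: "{e \<in> parcs (graph M). snd e = v} = {e \<in> parcs (graph N). snd e = v}"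
    unfolding in_reverse no using v by auto
  have outs: "{e \<in> parcs (graph M). fst e = v} = {e \<in> parcs (graph N). fst e = v}"
    unfolding out_reverse no using v side_vertices by auto
  have "edge_equation M l Ehat e (edge_combination M l Ehat e) \<longleftrightarrow>
      edge_equation N l E e (edge_combination N l E e)"
    if e: "e \<in> parcs (graph N)" "snd e = v" for e
  proof -
    have eQ: "e \<notin> set Q" using e v by blast
    have "edge_combination M l Ehat e = (\<Sum>f | f \<in> parcs (graph N) \<and> fst f = v. \<omega> e f *\<^sub>R \<sigma> e *\<^sub>R E f)"
      unfolding edge_combination_def e(2) outs
    proof (rule sum.cong[OF refl])
      fix f assume "f \<in> {f \<in> parcs (graph N). fst f = v}"
      then show "\<omega> e f *\<^sub>R Ehat f = \<omega> e f *\<^sub>R \<sigma> e *\<^sub>R E f"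
        using off[of f] gamma_off_trace[of e f] e v by auto
    qed
    also have "\<dots> = \<sigma> e *\<^sub>R edge_combination N l E e"
      unfolding edge_combination_def e(2) scaleR_sum_right by (simp add: mult.commute)
    finally have comb: "edge_combination M l Ehat e = \<sigma> e *\<^sub>R edge_combination N l E e" .
    have "Ehat e - (\<iota> e * weight N e) *\<^sub>R edge_combination M l Ehat e =
        \<sigma> e *\<^sub>R (E e - (\<iota> e * weight N e) *\<^sub>R edge_combination N l E e)"
      unfolding comb off[OF e(1) eQ] by (simp add: scaleR_diff_right mult_ac)
    then show ?thesis
      unfolding edge_equation_def weight_reverse(1)[OF e(1)] int_num_reverse
      by (subst scaleR_diff_imp_eq_iff[of _ _ "\<sigma> e" "E e"]) auto
  qed
  then show ?thesis unfolding ins by blast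
qed

context
  fixes v q1 q2
  assumes q: "q1 \<in> set Q" "q2 \<in> set Q" "snd q1 = v" "fst q2 = v"
begin

lemma sides_at: "{e \<in> set Q. fst e = v} = {q2}" "{e \<in> set Q. snd e = v} = {q1}"
proof -
  have "e = q2" if "e \<in> set Q" "fst e = v" for e
    using poly.start_inj[OF that(1) q(2)] that(2) q(4) by simp
  moreover have "e = q1" if "e \<in> set Q" "snd e = v" for e
    using poly.end_inj[OF that(1) q(1)] that(2) q(3) by simp
  ultimately show "{e \<in> set Q. fst e = v} = {q2}" "{e \<in> set Q. snd e = v} = {q1}"
    using q by blast+
qed

lemma sign_cycle: "\<sigma> q2 * \<iota> q2 = \<omega> (prod.swap q2) (prod.swap q1) * \<sigma> q1 * \<iota> q1 * \<omega> q1 q2"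
  unfolding sign_add[symmetric] using gamma_cycle_parity[OF q]
  by (intro sign_eqI) (simp add: add_ac)

text \<open>The equation of \<open>q1\<close> and that of the reversed \<open>q2\<close> are the
  same proportionality between \<open>E q1\<close> and \<open>E q2\<close>. Given it, the outgoing
  vectors \<open>E q2\<close> and \<open>Ehat (prod.swap q1)\<close> are interchangeable up to a
  factor, and the equation of every other incoming edge changes by a sign.\<close>

lemma equations_black:
  assumes out: "{e \<in> parcs (graph N). fst e = v} = {q2}"
  shows "(\<forall>e \<in> {e \<in> parcs (graph M). snd e = v}. edge_equation M l Ehat e (edge_combination M l Ehat e)) \<longleftrightarrow>
   (\<forall>e \<in> {e \<in> parcs (graph N). snd e = v}. edge_equation N l E e (edge_combination N l E e))"
proof -
  define H where "H = {e \<in> parcs (graph N). snd e = v \<and> e \<notin> set Q}"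
  have w: "weight N q1 \<noteq> 0" "weight N q2 \<noteq> 0" using weight_nonzero q by auto
  have ins: "{e \<in> parcs (graph N). snd e = v} = insert q1 H"
    "{e \<in> parcs (graph M). snd e = v} = insert (prod.swap q2) H"
    unfolding in_reverse sides_at H_def using sides_at(2) q(1,3) walk(3) by auto
  have "{e \<in> parcs (graph N). fst e = v \<and> e \<notin> set Q} = {e \<in> parcs (graph N). fst e = v} - set Q"
    by blast
  then have "{e \<in> parcs (graph N). fst e = v \<and> e \<notin> set Q} = {}" unfolding out using q(2) by simp
  then have outM: "{e \<in> parcs (graph M). fst e = v} = {prod.swap q1}"
    unfolding out_reverse sides_at by (simp only: image_insert image_empty Un_empty_left)
  have combN: "edge_combination N l E e = \<omega> e q2 *\<^sub>R E q2" if "snd e = v" for e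
    using that out by (simp add: edge_combination_def)
  have combM: "edge_combination M l Ehat e = (\<omega> e (prod.swap q1) * \<sigma> q1 / weight N q1) *\<^sub>R E q1" if "snd e = v" for e
    using that outM on[OF q(1)] by (simp add: edge_combination_def)
  have eq1: "edge_equation N l E q1 (edge_combination N l E q1) \<longleftrightarrow> E q1 = (\<iota> q1 * weight N q1 * \<omega> q1 q2) *\<^sub>R E q2"
    using q(3) by (simp add: edge_equation_def combN mult.assoc)
  \<comment> \<open>The factor from the residual of \<open>q1\<close> to that of the reversed
    \<open>q2\<close>, read off from the coefficient of \<open>E q1\<close>. That the coefficient of
    \<open>E q2\<close> fits is \<open>sign_cycle\<close>.\<close>
  let ?c = "- (\<iota> q2 * \<omega> (prod.swap q2) (prod.swap q1) * \<sigma> q1 / (weight N q1 * weight N q2))"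
  have "\<iota> q2 * \<omega> (prod.swap q2) (prod.swap q1) * \<sigma> q1 * (\<iota> q1 * \<omega> q1 q2) = \<iota> q2 * (\<sigma> q2 * \<iota> q2)"
    unfolding sign_cycle by (simp add: mult_ac)
  also have "\<dots> = \<sigma> q2" by (simp add: mult.commute mult.left_commute)
  finally have s: "\<iota> q2 * \<omega> (prod.swap q2) (prod.swap q1) * \<sigma> q1 * (\<iota> q1 * \<omega> q1 q2) = \<sigma> q2" .
  have c: "- ?c * (\<iota> q1 * weight N q1 * \<omega> q1 q2) = \<sigma> q2 / weight N q2"
    using w s by (simp add: field_simps)
  have "edge_equation M l Ehat (prod.swap q2) (edge_combination M l Ehat (prod.swap q2)) \<longleftrightarrow>
      (\<sigma> q2 / weight N q2) *\<^sub>R E q2 = (- ?c) *\<^sub>R E q1"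
    using q(4) w by (simp add: edge_equation_def combM on[OF q(2)] weight_reverse(2)[OF q(2)]
        int_num_reverse int_num_swap mult_ac)
  also have "\<dots> \<longleftrightarrow> E q1 = (\<iota> q1 * weight N q1 * \<omega> q1 q2) *\<^sub>R E q2"
  proof (rule scaleR_diff_imp_eq_iff[symmetric])
    show "(\<sigma> q2 / weight N q2) *\<^sub>R E q2 - (- ?c) *\<^sub>R E q1 =
      ?c *\<^sub>R (E q1 - (\<iota> q1 * weight N q1 * \<omega> q1 q2) *\<^sub>R E q2)"
      unfolding c[symmetric] by (simp add: scaleR_diff_right)
    show "?c \<noteq> 0" using w by simp
  qed
  finally have eq2: "edge_equation M l Ehat (prod.swap q2) (edge_combination M l Ehat (prod.swap q2)) \<longleftrightarrow>
    E q1 = (\<iota> q1 * weight N q1 * \<omega> q1 q2) *\<^sub>R E q2" .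
  have eqH: "edge_equation M l Ehat e (edge_combination M l Ehat e) \<longleftrightarrow>
      edge_equation N l E e (edge_combination N l E e)"
    if e: "e \<in> H" and E1: "E q1 = (\<iota> q1 * weight N q1 * \<omega> q1 q2) *\<^sub>R E q2" for e
  proof -
    have e': "e \<in> parcs (graph N)" "e \<notin> set Q" "snd e = v" using e unfolding H_def by auto
    have s: "\<sigma> e * \<omega> e q2 = \<omega> e (prod.swap q1) * \<sigma> q1 * \<iota> q1 * \<omega> q1 q2"
      unfolding sign_add[symmetric] using gamma_incoming_parity[OF q e']
      by (intro sign_eqI) (simp add: add_ac)
    have "edge_combination M l Ehat e = (\<omega> e (prod.swap q1) * \<sigma> q1 * \<iota> q1 * \<omega> q1 q2) *\<^sub>R E q2"
      unfolding combM[OF e'(3)] E1 using w by (simp add: mult_ac)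
    then have "edge_combination M l Ehat e = \<sigma> e *\<^sub>R edge_combination N l E e"
      unfolding combN[OF e'(3)] s[symmetric] by simp
    then have "Ehat e - (\<iota> e * weight N e) *\<^sub>R edge_combination M l Ehat e =
        \<sigma> e *\<^sub>R (E e - (\<iota> e * weight N e) *\<^sub>R edge_combination N l E e)"
      unfolding off[OF e'(1,2)] by (simp add: scaleR_diff_right mult_ac)
    then show ?thesis
      unfolding edge_equation_def weight_reverse(1)[OF e'(1)] int_num_reverse
      by (subst scaleR_diff_imp_eq_iff[of _ _ "\<sigma> e" "E e"]) auto
  qed
  show ?thesis unfolding ins using eq1 eq2 eqH by blast
qed

text \<open>Each orientation has a single equation here, with \<open>q1\<close> or the reversed
  \<open>q2\<close> on the left. The reversed one is the original one solved for \<open>E q2\<close>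
  and rescaled.\<close>

lemma equations_white:
  assumes inc: "{e \<in> parcs (graph N). snd e = v} = {q1}"
  shows "(\<forall>e \<in> {e \<in> parcs (graph M). snd e = v}. edge_equation M l Ehat e (edge_combination M l Ehat e)) \<longleftrightarrow>
   (\<forall>e \<in> {e \<in> parcs (graph N). snd e = v}. edge_equation N l E e (edge_combination N l E e))"
proof -
  define G where "G = {e \<in> parcs (graph N). fst e = v \<and> e \<notin> set Q}"
  have w: "weight N q1 \<noteq> 0" "weight N q2 \<noteq> 0" using weight_nonzero q by auto
  have "{e \<in> parcs (graph N). snd e = v \<and> e \<notin> set Q} = {e \<in> parcs (graph N). snd e = v} - set Q"
    by blast
  then have "{e \<in> parcs (graph N). snd e = v \<and> e \<notin> set Q} = {}" unfolding inc using q(1) by simp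
  then have inM: "{e \<in> parcs (graph M). snd e = v} = {prod.swap q2}"
    unfolding in_reverse sides_at by (simp only: image_insert image_empty Un_empty_left)
  have outs: "{e \<in> parcs (graph N). fst e = v} = insert q2 G"
    "{e \<in> parcs (graph M). fst e = v} = insert (prod.swap q1) G"
    unfolding out_reverse sides_at G_def using sides_at(1) q(2,4) walk(3) by auto
  have G: "finite G" "q2 \<notin> G" "prod.swap q1 \<notin> G"
    using q(1,2) walk(3) reverse_not_arc[of q1] finite_arcs_at unfolding G_def by auto
  define S where "S = (\<Sum>g\<in>G. \<omega> q1 g *\<^sub>R E g)"
  let ?q1 = "prod.swap q1" and ?q2 = "prod.swap q2"
  have combN: "edge_combination N l E q1 = \<omega> q1 q2 *\<^sub>R E q2 + S"
    unfolding edge_combination_def q(3) outs using G by (simp add: S_def)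
  have "(\<Sum>g\<in>G. \<omega> ?q2 g *\<^sub>R Ehat g) = (\<Sum>g\<in>G. - ((\<omega> ?q2 ?q1 * \<sigma> q1 * \<iota> q1) *\<^sub>R \<omega> q1 g *\<^sub>R E g))"
  proof (rule sum.cong[OF refl])
    fix g assume "g \<in> G"
    then have g: "g \<in> parcs (graph N)" "g \<notin> set Q" "fst g = v" unfolding G_def by auto
    \<comment> \<open>The minus sign accounts for the other outgoing edges changing sides when the
      equation is solved for \<open>E q2\<close>. It comes from the odd parity in
      \<open>gamma_outgoing_parity\<close>.\<close>
    have "\<omega> ?q2 g * \<sigma> g = - (\<omega> ?q2 ?q1 * \<sigma> q1 * \<iota> q1 * \<omega> q1 g)"
      unfolding sign_add[symmetric] using gamma_outgoing_parity[OF q g]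
      by (intro sign_eq_minusI) (simp add: add_ac)
    then show "\<omega> ?q2 g *\<^sub>R Ehat g = - ((\<omega> ?q2 ?q1 * \<sigma> q1 * \<iota> q1) *\<^sub>R \<omega> q1 g *\<^sub>R E g)"
      using off[OF g(1,2)] by simp
  qed
  also have "\<dots> = - ((\<omega> ?q2 ?q1 * \<sigma> q1 * \<iota> q1) *\<^sub>R S)"
    unfolding S_def scaleR_sum_right sum_negf ..
  finally have sumM: "(\<Sum>g\<in>G. \<omega> ?q2 g *\<^sub>R Ehat g) = - ((\<omega> ?q2 ?q1 * \<sigma> q1 * \<iota> q1) *\<^sub>R S)" .
  have "snd ?q2 = v" using q(4) by simp
  then have combM: "edge_combination M l Ehat ?q2 =
      (\<omega> ?q2 ?q1 * \<sigma> q1 / weight N q1) *\<^sub>R E q1 - (\<omega> ?q2 ?q1 * \<sigma> q1 * \<iota> q1) *\<^sub>R S"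
    unfolding edge_combination_def using outs(2) G(1,3) sumM on[OF q(1)] by simp
  let ?c = "- (\<iota> q2 * \<omega> ?q2 ?q1 * \<sigma> q1 / (weight N q1 * weight N q2))"
  have "\<iota> q2 * \<omega> ?q2 ?q1 * \<sigma> q1 * (\<iota> q1 * \<omega> q1 q2) = \<iota> q2 * (\<sigma> q2 * \<iota> q2)"
    unfolding sign_cycle by (simp add: mult_ac)
  also have "\<dots> = \<sigma> q2" by (simp add: mult.commute mult.left_commute)
  finally have s: "\<iota> q2 * \<omega> ?q2 ?q1 * \<sigma> q1 * (\<iota> q1 * \<omega> q1 q2) = \<sigma> q2" .
  have c: "\<sigma> q2 / weight N q2 = - ?c * (\<iota> q1 * weight N q1 * \<omega> q1 q2)"
    "\<iota> q2 / weight N q2 * (\<omega> ?q2 ?q1 * \<sigma> q1 * \<iota> q1) = - ?c * (\<iota> q1 * weight N q1)"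
    using w s by (simp_all add: field_simps)
  have "(\<sigma> q2 / weight N q2) *\<^sub>R E q2 - (\<iota> q2 / weight N q2) *\<^sub>R edge_combination M l Ehat ?q2 =
      ?c *\<^sub>R (E q1 - (\<iota> q1 * weight N q1) *\<^sub>R edge_combination N l E q1)"
  proof -
    have "(\<iota> q2 / weight N q2) *\<^sub>R edge_combination M l Ehat ?q2 =
        (- ?c) *\<^sub>R E q1 - (\<iota> q2 / weight N q2 * (\<omega> ?q2 ?q1 * \<sigma> q1 * \<iota> q1)) *\<^sub>R S"
      unfolding combM using w by (simp add: scaleR_diff_right mult_ac)
    then show ?thesis unfolding c combN by (simp add: scaleR_diff_right scaleR_add_right)
  qed
  moreover have "?c \<noteq> 0" using w by simp
  ultimately have "E q1 = (\<iota> q1 * weight N q1) *\<^sub>R edge_combination N l E q1 \<longleftrightarrow>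
      (\<sigma> q2 / weight N q2) *\<^sub>R E q2 = (\<iota> q2 / weight N q2) *\<^sub>R edge_combination M l Ehat ?q2"
    by (rule scaleR_diff_imp_eq_iff)
  then show ?thesis
    unfolding inM inc by (simp add: edge_equation_def on[OF q(2)] weight_reverse(2)[OF q(2)]
        int_num_reverse int_num_swap)
qed

end

lemma equations_at_internal:
  assumes v: "v \<in> internal N"
  shows "(\<forall>e \<in> {e \<in> parcs (graph M). snd e = v}. edge_equation M l Ehat e (edge_combination M l Ehat e)) \<longleftrightarrow>
   (\<forall>e \<in> {e \<in> parcs (graph N). snd e = v}. edge_equation N l E e (edge_combination N l E e))"
proof (cases "v \<in> snd ` set Q")
  case True
  then obtain q1 q2 where q: "q1 \<in> set Q" "q2 \<in> set Q" "snd q1 = v" "fst q2 = v" by (rule cycle_vertex)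
  show ?thesis
  proof (cases "colour N v")
    case White
    have "card {e \<in> parcs (graph N). snd e = v} = 1"
      using perfect_white[OF v White] by (simp add: in_degree_def in_arcs_def)
    moreover have "q1 \<in> {e \<in> parcs (graph N). snd e = v}" using q walk(3) by auto
    ultimately have "{e \<in> parcs (graph N). snd e = v} = {q1}" by (metis card_1_singletonE singletonD)
    then show ?thesis by (rule equations_white[OF q])
  next
    case Black
    have "card {e \<in> parcs (graph N). fst e = v} = 1"
      using perfect_black[OF v Black] by (simp add: out_degree_def out_arcs_def)
    moreover have "q2 \<in> {e \<in> parcs (graph N). fst e = v}" using q walk(3) by auto
    ultimately have "{e \<in> parcs (graph N). fst e = v} = {q2}" by (metis card_1_singletonE singletonD)
    then show ?thesis by (rule equations_black[OF q])
  qed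
qed (rule equations_off_cycle)

text \<open>Neither family is assumed to be a solution. The equivalence thus serves existence in one
  direction and uniqueness in the other.\<close>

lemma solves_reverse_iff: "solves_edge_equations M l B Ehat \<longleftrightarrow> solves_edge_equations N l B E"
  unfolding solves_edge_equations_iff internal_reverse pivots_reverse bvert_reverse
  using equations_at_internal sink_equations by simp

end

lemma edge_vector_system_reverse:
  assumes E: "edge_vector_system N l B E"
    and off: "\<And>e. e \<in> parcs (graph N) \<Longrightarrow> e \<notin> set Q \<Longrightarrow> Ehat e = \<sigma> e *\<^sub>R E e"
    and on: "\<And>e. e \<in> set Q \<Longrightarrow> Ehat (prod.swap e) = (\<sigma> e / weight N e) *\<^sub>R E e"
  shows "edge_vector_system M l B Ehat"
  unfolding edge_vector_system_def
proof (intro conjI allI impI ballI)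
  show "solves_edge_equations M l B Ehat"
    using solves_reverse_iff[of Ehat E, OF off on] E unfolding edge_vector_system_def by blast
next
  fix F e assume F: "solves_edge_equations M l B F" and e: "e \<in> parcs (graph M)"
  \<comment> \<open>The inverse rescaling: signs are their own inverses, and the weights of the
    sides are multiplied back. Uniqueness on \<open>N\<close> then identifies \<open>F'\<close> with
    \<open>E\<close>.\<close>
  define F' where "F' e = (if e \<in> set Q then (\<sigma> e * weight N e) *\<^sub>R F (prod.swap e) else \<sigma> e *\<^sub>R F e)" for e
  have F': "F e = \<sigma> e *\<^sub>R F' e" if "e \<notin> set Q" for e using that by (simp add: F'_def)
  have F'Q: "F (prod.swap e) = (\<sigma> e / weight N e) *\<^sub>R F' e" if "e \<in> set Q" for e
    using that weight_nonzero[OF that] by (simp add: F'_def)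
  have "solves_edge_equations N l B F'" using solves_reverse_iff[of F F' B] F F' F'Q by blast
  then have "F' e = E e" if "e \<in> parcs (graph N)" for e
    using E that unfolding edge_vector_system_def by blast
  note eq = this
  from e consider "e \<in> parcs (graph N)" "e \<notin> set Q" | q where "q \<in> set Q" "e = prod.swap q"
    unfolding parcs_reverse by blast
  then show "F e = Ehat e"
  proof cases
    case 1
    show ?thesis unfolding off[OF 1] F'[OF 1(2)] eq[OF 1(1)] ..
  next
    case (2 q)
    then have "q \<in> parcs (graph N)" using walk(3) by blast
    then show ?thesis unfolding 2(2) on[OF 2(1)] F'Q[OF 2(1)] by (simp only: eq)
  qed
qed

end

theorem lemma4p7:
  fixes N :: "'n :: {finite, linorder} plabic_data"
    and l :: complex
    and Q0 :: "(complex \<times> complex) list"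
    and E Ehat :: "complex \<times> complex \<Rightarrow> real ^ ('n :: {finite, linorder})"
  assumes "plabic_network N"
    and "gauge_direction N l"
    and "edge_vector_system N l (\<lambda>j. axis j 1) E"
    and "pre_digraph.cycle (with_proj (graph N)) Q0"
    and "\<And>e. e \<in> parcs (graph N) - set Q0 \<Longrightarrow> Ehat e = ((-1) powi gamma N l Q0 e) *\<^sub>R E e"
    and "\<And>e. e \<in> set Q0 \<Longrightarrow>
      Ehat (prod.swap e) = ((-1) powi gamma N l Q0 e / weight N e) *\<^sub>R E e"
  shows "edge_vector_system (reverse_along Q0 N) l (\<lambda>j. axis j 1) Ehat"
proof -
  interpret plabic_network N by (rule assms(1))
  obtain u where u: "awalk u Q0 u" "distinct (tl (pawalk_verts u Q0))" "Q0 \<noteq> []"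
    using assms(4) unfolding cycle_def by blast
  \<comment> \<open>A cycle is required to have distinct vertices after the first. These are
    precisely the ends of its edges.\<close>
  have "pawalk_verts v es = v # map snd es" if "pcas v es w" for v w and es :: "(complex \<times> complex) list"
    using that by (induction es arbitrary: v) auto
  then have "pcas u Q0 u \<Longrightarrow> distinct (map snd Q0)" using u(2) by simp
  then interpret network_cycle N l Q0 u
    using u assms(2) by unfold_locales (auto simp: awalk_def)
  show ?thesis
    using edge_vector_system_reverse[OF assms(3)] assms(5,6) by (simp add: sign_powi)
qed

end
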